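(* Let $d\ge1$ and let $\Omega\subset\mathbb{R}^d$ be a domain that is bounded at least in one direction (i.e. it lies between two parallel hyperplanes), with Friedrichs constant $c_{\mathsf f}>0$. Let $f\in L^2(\Omega)$. Let $(u,p)\in \mathring{H}^1(\Omega)\times D(\Omega)$ be the exact solution of the Poisson problem $$-\nabla u+p=0\ \text{ in }\Omega,\qquad -\operatorname{div}p=f\ \text{ in }\Omega,$$ and let $(\tilde u,\tilde p)\in \mathring{H}^1(\Omega)\times D(\Omega)$ be an arbitrary approximation. Then $$\max\Big\{\|f+\operatorname{div}\tilde p\|_{L^2(\Omega)}^2+\tfrac12\|\tilde p-\nabla\tilde u\|_{L^2(\Omega)}^2\ ;\ \tfrac{1}{1+c_{\mathsf f}^2}\|\tilde p-\nabla\tilde u\|_{L^2(\Omega)}^2\Big\}\le \|\nabla(u-\tilde u)\|_{L^2(\Omega)}^2+\|p-\tilde p\|_{D(\Omega)}^2$$ and $$\|\nabla(u-\tilde u)\|_{L^2(\Omega)}^2+\|p-\tilde p\|_{D(\Omega)}^2\le (1+4c_{\mathsf f}^2)\|f+\operatorname{div}\tilde p\|_{L^2(\Omega)}^2+2\|\tilde p-\nabla\tilde u\|_{L^2(\Omega)}^2 .$$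
   Context: All functions and vector fields are real valued; $L^2(\Omega)$ is used for both scalar functions and $\mathbb{R}^d$-valued vector fields; derivatives are weak. $H^1(\Omega)=\{\varphi\in L^2(\Omega): \nabla\varphi\in L^2(\Omega)\}$ with its graph norm. $D(\Omega)=\{\psi\in L^2(\Omega):\operatorname{div}\psi\in L^2(\Omega)\}$ (vector fields) with $\|\psi\|_{D(\Omega)}^2=\|\psi\|_{L^2(\Omega)}^2+\|\operatorname{div}\psi\|_{L^2(\Omega)}^2$. $\mathring{H}^1(\Omega)$ is the closure in $H^1(\Omega)$ of the smooth functions with compact support in $\Omega$. The Friedrichs constant $c_{\mathsf f}>0$ is the constant in the Friedrichs inequality $\|\varphi\|_{L^2(\Omega)}\le c_{\mathsf f}\|\nabla\varphi\|_{L^2(\Omega)}$ for all $\varphi\in\mathring{H}^1(\Omega)$, which holds because $\Omega$ is bounded in one direction. The stated problem has a unique solution $(u,p)\in \mathring{H}^1(\Omega)\times D(\Omega)$. *)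

theory Defs
  imports "HOL-Analysis.Analysis"
begin

text \<open>Euclidean space of arbitrary dimension \<open>d \<ge> 1\<close> is an arbitrary type of class
  \<^class>\<open>euclidean_space\<close>; scalar functions have type \<open>'a \<Rightarrow> real\<close> and vector fields type
  \<open>'a \<Rightarrow> 'a\<close>. Elements of \<open>L\<^sup>2(\<Omega>)\<close> are represented by functions on the whole type, of which only
  the values on \<open>\<Omega>\<close>, up to null sets, matter.\<close>

definition domain_set :: "'a::euclidean_space set \<Rightarrow> bool" where
  "domain_set \<Omega> \<longleftrightarrow> open \<Omega> \<and> connected \<Omega> \<and> \<Omega> \<noteq> {}"

definition bounded_in_one_direction :: "'a::euclidean_space set \<Rightarrow> bool" where
  "bounded_in_one_direction \<Omega> \<longleftrightarrow> (\<exists>v a b. v \<noteq> 0 \<and> (\<forall>x\<in>\<Omega>. a \<le> v \<bullet> x \<and> v \<bullet> x \<le> b))"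

definition L2 :: "'a::euclidean_space set \<Rightarrow> ('a \<Rightarrow> 'b::euclidean_space) set" where
  "L2 \<Omega> = {f. f \<in> borel_measurable (lebesgue_on \<Omega>) \<and>
              integrable (lebesgue_on \<Omega>) (\<lambda>x. (norm (f x))\<^sup>2)}"

definition L2_norm :: "'a::euclidean_space set \<Rightarrow> ('a \<Rightarrow> 'b::euclidean_space) \<Rightarrow> real" where
  "L2_norm \<Omega> f = sqrt (LINT x|lebesgue_on \<Omega>. (norm (f x))\<^sup>2)"

definition partial :: "'a::euclidean_space \<Rightarrow> ('a \<Rightarrow> real) \<Rightarrow> 'a \<Rightarrow> real" where
  "partial b \<theta> x = frechet_derivative \<theta> (at x) b"

definition gradient :: "('a::euclidean_space \<Rightarrow> real) \<Rightarrow> 'a \<Rightarrow> 'a" where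
  "gradient \<theta> x = (\<Sum>b\<in>Basis. partial b \<theta> x *\<^sub>R b)"

primrec k_times_cont_diff :: "nat \<Rightarrow> ('a::euclidean_space \<Rightarrow> real) \<Rightarrow> bool" where
  "k_times_cont_diff 0 \<theta> \<longleftrightarrow> continuous_on UNIV \<theta>"
| "k_times_cont_diff (Suc k) \<theta> \<longleftrightarrow>
     (\<forall>x. \<theta> differentiable (at x)) \<and> (\<forall>b\<in>Basis. k_times_cont_diff k (partial b \<theta>))"

definition smooth :: "('a::euclidean_space \<Rightarrow> real) \<Rightarrow> bool" where
  "smooth \<theta> \<longleftrightarrow> (\<forall>k. k_times_cont_diff k \<theta>)"

text \<open>Smooth functions with compact support in \<open>\<Omega>\<close>, extended by zero outside \<open>\<Omega>\<close>.\<close>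

definition test_functions :: "'a::euclidean_space set \<Rightarrow> ('a \<Rightarrow> real) set" where
  "test_functions \<Omega> =
     {\<theta>. smooth \<theta> \<and> compact (closure {x. \<theta> x \<noteq> 0}) \<and> closure {x. \<theta> x \<noteq> 0} \<subseteq> \<Omega>}"

definition is_weak_gradient ::
  "'a::euclidean_space set \<Rightarrow> ('a \<Rightarrow> real) \<Rightarrow> ('a \<Rightarrow> 'a) \<Rightarrow> bool" where
  "is_weak_gradient \<Omega> \<phi> g \<longleftrightarrow>
     (\<forall>\<theta>\<in>test_functions \<Omega>. \<forall>b\<in>Basis.
        (LINT x|lebesgue_on \<Omega>. \<phi> x * partial b \<theta> x) =
        - (LINT x|lebesgue_on \<Omega>. (g x \<bullet> b) * \<theta> x))"

definition is_weak_divergence ::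
  "'a::euclidean_space set \<Rightarrow> ('a \<Rightarrow> 'a) \<Rightarrow> ('a \<Rightarrow> real) \<Rightarrow> bool" where
  "is_weak_divergence \<Omega> \<psi> w \<longleftrightarrow>
     (\<forall>\<theta>\<in>test_functions \<Omega>.
        (LINT x|lebesgue_on \<Omega>. \<psi> x \<bullet> gradient \<theta> x) =
        - (LINT x|lebesgue_on \<Omega>. w x * \<theta> x))"

definition H1 :: "'a::euclidean_space set \<Rightarrow> ('a \<Rightarrow> real) set" where
  "H1 \<Omega> = {\<phi> \<in> L2 \<Omega>. \<exists>g\<in>L2 \<Omega>. is_weak_gradient \<Omega> \<phi> g}"

definition Hdiv :: "'a::euclidean_space set \<Rightarrow> ('a \<Rightarrow> 'a) set" where
  "Hdiv \<Omega> = {\<psi> \<in> L2 \<Omega>. \<exists>w\<in>L2 \<Omega>. is_weak_divergence \<Omega> \<psi> w}"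

text \<open>Weak derivatives are unique only up to null sets; the following operators choose a
  representative, and are meaningful on \<^const>\<open>H1\<close> and \<^const>\<open>Hdiv\<close> respectively.\<close>

definition wgrad :: "'a::euclidean_space set \<Rightarrow> ('a \<Rightarrow> real) \<Rightarrow> 'a \<Rightarrow> 'a" where
  "wgrad \<Omega> \<phi> = (SOME g. g \<in> L2 \<Omega> \<and> is_weak_gradient \<Omega> \<phi> g)"

definition wdiv :: "'a::euclidean_space set \<Rightarrow> ('a \<Rightarrow> 'a) \<Rightarrow> 'a \<Rightarrow> real" where
  "wdiv \<Omega> \<psi> = (SOME w. w \<in> L2 \<Omega> \<and> is_weak_divergence \<Omega> \<psi> w)"

definition H1_norm :: "'a::euclidean_space set \<Rightarrow> ('a \<Rightarrow> real) \<Rightarrow> real" where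
  "H1_norm \<Omega> \<phi> = sqrt ((L2_norm \<Omega> \<phi>)\<^sup>2 + (L2_norm \<Omega> (wgrad \<Omega> \<phi>))\<^sup>2)"

definition Hdiv_norm :: "'a::euclidean_space set \<Rightarrow> ('a \<Rightarrow> 'a) \<Rightarrow> real" where
  "Hdiv_norm \<Omega> \<psi> = sqrt ((L2_norm \<Omega> \<psi>)\<^sup>2 + (L2_norm \<Omega> (wdiv \<Omega> \<psi>))\<^sup>2)"

definition H1_0 :: "'a::euclidean_space set \<Rightarrow> ('a \<Rightarrow> real) set" where
  "H1_0 \<Omega> = {\<phi> \<in> H1 \<Omega>. \<forall>\<epsilon>>0. \<exists>\<theta>\<in>test_functions \<Omega>. H1_norm \<Omega> (\<lambda>x. \<phi> x - \<theta> x) < \<epsilon>}"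

text \<open>Any admissible constant is allowed, not only the best one.\<close>

definition friedrichs_constant :: "'a::euclidean_space set \<Rightarrow> real \<Rightarrow> bool" where
  "friedrichs_constant \<Omega> c \<longleftrightarrow>
     c > 0 \<and> (\<forall>\<phi>\<in>H1_0 \<Omega>. L2_norm \<Omega> \<phi> \<le> c * L2_norm \<Omega> (wgrad \<Omega> \<phi>))"

text \<open>The system \<open>-\<nabla>u + p = 0\<close>, \<open>-div p = f\<close> is an identity in \<open>L\<^sup>2(\<Omega>)\<close>, i.e. almost everywhere.\<close>

definition poisson_solution ::
  "'a::euclidean_space set \<Rightarrow> ('a \<Rightarrow> real) \<Rightarrow> ('a \<Rightarrow> real) \<Rightarrow> ('a \<Rightarrow> 'a) \<Rightarrow> bool" where
  "poisson_solution \<Omega> f u p \<longleftrightarrow>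
     u \<in> H1_0 \<Omega> \<and> p \<in> Hdiv \<Omega> \<and>
     (AE x in lebesgue_on \<Omega>. - wgrad \<Omega> u x + p x = 0) \<and>
     (AE x in lebesgue_on \<Omega>. - wdiv \<Omega> p x = f x)"

end

theory Submission
  imports Defs
begin

text \<open>
  Put \<open>e = u - u'\<close> and \<open>q = p - p'\<close>. The exact equations turn the two computable residuals into
  quantities of the error alone: \<open>p' - \<nabla>u' = \<nabla>e - q\<close> and \<open>f + div p' = - div q\<close>. Hence
  \<open>\<parallel>p' - \<nabla>u'\<parallel>\<^sup>2 = \<parallel>\<nabla>e\<parallel>\<^sup>2 + \<parallel>q\<parallel>\<^sup>2 - 2 \<langle>\<nabla>e, q\<rangle>\<close>, and since \<open>e\<close> vanishes on the boundary in the
  sense of \<^const>\<open>H1_0\<close>, the lemma \<open>Green_formula\<close> replaces \<open>\<langle>\<nabla>e, q\<rangle>\<close> by \<open>- \<langle>e, div q\<rangle>\<close>. By the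
  Cauchy-Schwarz and Friedrichs inequalities this cross term is at most
  \<open>c \<parallel>\<nabla>e\<parallel> \<parallel>div q\<parallel>\<close>, and Young's inequality, weighted differently for the two directions, gives
  both bounds (\<open>error_residual_estimates\<close>). The first entry of the maximum needs only
  \<open>\<parallel>\<nabla>e - q\<parallel>\<^sup>2 \<le> 2 (\<parallel>\<nabla>e\<parallel>\<^sup>2 + \<parallel>q\<parallel>\<^sup>2)\<close>.

  Most of the work lies in the calculus of weak derivatives that this argument takes for granted.
  The operators \<^const>\<open>wgrad\<close> and \<^const>\<open>wdiv\<close> pick an arbitrary representative, so their
  linearity rests on the almost everywhere uniqueness of weak derivatives, that is, on the
  fundamental lemma of the calculus of variations
  (\<open>fundamental_lemma_calculus_of_variations\<close>), for which smooth bumps approximating indicators of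
  boxes are constructed. Green's formula extends by density from test functions; there the weak
  gradient has to be identified with the classical one, which is integration by parts
  (\<open>test_function_is_weak_gradient\<close>).
\<close>

section \<open>Calculus of smooth functions\<close>

lemma k_times_cont_diff_continuous: "k_times_cont_diff k \<theta> \<Longrightarrow> continuous_on UNIV \<theta>"
  by (cases k) (auto intro!: continuous_at_imp_continuous_on differentiable_imp_continuous_within)

text \<open>The recursive definition demands continuity only of the derivatives of the highest order.
  At the bottom of the recursion the step down therefore appeals to the fact that differentiable
  functions are continuous.\<close>

lemma k_times_cont_diff_SucD: "k_times_cont_diff (Suc k) \<theta> \<Longrightarrow> k_times_cont_diff k \<theta>"
proof (induction k arbitrary: \<theta>)
  case 0
  then show ?case using k_times_cont_diff_continuous[of "Suc 0"] by simp
next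
  case (Suc k)
  then show ?case by simp
qed

lemma partial_eqI: "(\<theta> has_derivative D) (at x) \<Longrightarrow> partial b \<theta> x = D b"
  unfolding partial_def by (metis frechet_derivative_at)

lemma partial_has_derivative:
  "\<theta> differentiable (at x) \<Longrightarrow> (\<theta> has_derivative (\<lambda>h. partial h \<theta> x)) (at x)"
  unfolding partial_def by (simp add: frechet_derivative_works)

lemma partial_diff:
  assumes "\<theta> differentiable (at x)" "\<eta> differentiable (at x)"
  shows "partial b (\<lambda>x. \<theta> x - \<eta> x) x = partial b \<theta> x - partial b \<eta> x"
  by (rule partial_eqI)
    (auto intro!: derivative_eq_intros partial_has_derivative assms)

lemma partial_mult:
  assumes "\<theta> differentiable (at x)" "\<eta> differentiable (at x)"
  shows "partial b (\<lambda>x. \<theta> x * \<eta> x) x = \<theta> x * partial b \<eta> x + partial b \<theta> x * \<eta> x"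
  by (rule partial_eqI)
    (auto intro!: derivative_eq_intros partial_has_derivative assms)

lemma k_times_cont_diff_diff:
  "k_times_cont_diff k \<theta> \<Longrightarrow> k_times_cont_diff k \<eta> \<Longrightarrow> k_times_cont_diff k (\<lambda>x. \<theta> x - \<eta> x)"
proof (induction k arbitrary: \<theta> \<eta>)
  case (Suc k)
  then have "partial b (\<lambda>x. \<theta> x - \<eta> x) = (\<lambda>x. partial b \<theta> x - partial b \<eta> x)" for b
    by (auto simp: partial_diff)
  then show ?case using Suc by simp
qed (auto intro: continuous_intros)

lemma k_times_cont_diff_add:
  "k_times_cont_diff k \<theta> \<Longrightarrow> k_times_cont_diff k \<eta> \<Longrightarrow> k_times_cont_diff k (\<lambda>x. \<theta> x + \<eta> x)"
proof (induction k arbitrary: \<theta> \<eta>)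
  case (Suc k)
  have "partial b (\<lambda>x. \<theta> x + \<eta> x) = (\<lambda>x. partial b \<theta> x + partial b \<eta> x)" for b
    using Suc.prems by (intro ext partial_eqI) (auto intro!: derivative_eq_intros partial_has_derivative)
  then show ?case using Suc by simp
qed (auto intro: continuous_intros)

lemma k_times_cont_diff_mult:
  "k_times_cont_diff k \<theta> \<Longrightarrow> k_times_cont_diff k \<eta> \<Longrightarrow> k_times_cont_diff k (\<lambda>x. \<theta> x * \<eta> x)"
proof (induction k arbitrary: \<theta> \<eta>)
  case (Suc k)
  then have "partial b (\<lambda>x. \<theta> x * \<eta> x) = (\<lambda>x. \<theta> x * partial b \<eta> x + partial b \<theta> x * \<eta> x)" for b
    by (auto simp: partial_mult)
  then show ?case using Suc k_times_cont_diff_SucD[OF Suc.prems(1)] k_times_cont_diff_SucD[OF Suc.prems(2)]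
    by (auto intro!: k_times_cont_diff_add)
qed (auto intro: continuous_intros)

lemma k_times_cont_diff_const: "k_times_cont_diff k (\<lambda>x. c)"
proof (induction k arbitrary: c)
  case (Suc k)
  have "partial b (\<lambda>x::'a. c) = (\<lambda>x. 0)" for b
    by (auto intro!: partial_eqI derivative_eq_intros)
  then show ?case using Suc by simp
qed auto

lemma k_times_cont_diff_prod:
  assumes "\<And>i. i \<in> I \<Longrightarrow> k_times_cont_diff k (\<theta> i)"
  shows "k_times_cont_diff k (\<lambda>x. \<Prod>i\<in>I. \<theta> i x)"
  using assms
  by (induction I rule: infinite_finite_induct)
    (auto intro: k_times_cont_diff_const k_times_cont_diff_mult)

section \<open>Smooth bumps on boxes\<close>

text \<open>Dividing by powers of \<open>t\<close> makes the family closed under differentiation up to linear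
  combinations, so the smoothness of \<open>flat 0\<close>, the classical flat function \<open>exp (- 1 / t)\<close>, follows
  by one induction over all \<open>m\<close> simultaneously.\<close>

definition flat :: "nat \<Rightarrow> real \<Rightarrow> real" where
  "flat m t = (if t > 0 then exp (- (1 / t)) / t ^ m else 0)"

text \<open>With \<open>s = 1 / t\<close> the limit from the right is the statement that \<open>exp s\<close> outgrows
  every power of \<open>s\<close>.\<close>

lemma flat_tendsto_0: "(flat m \<longlongrightarrow> 0) (at 0)"
proof -
  have "((\<lambda>t. inverse t ^ m / exp (inverse t)) \<longlongrightarrow> 0) (at_right (0::real))"
    by (rule filterlim_compose[OF tendsto_power_div_exp_0 filterlim_inverse_at_top_right])
  then have "(flat m \<longlongrightarrow> 0) (at_right 0)"
    by (rule Lim_transform_eventually)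
      (auto simp: eventually_at_filter flat_def exp_minus field_simps)
  moreover have "(flat m \<longlongrightarrow> 0) (at_left 0)"
    by (rule Lim_transform_eventually[OF tendsto_const])
      (auto simp: eventually_at_filter flat_def)
  ultimately show ?thesis by (simp add: filterlim_at_split)
qed

text \<open>At the origin the difference quotient of \<open>flat m\<close> is \<open>flat (m + 1)\<close>, so differentiability
  there is again \<open>flat_tendsto_0\<close>.\<close>

lemma flat_has_derivative:
  "(flat m has_real_derivative flat (m + 2) t - real m * flat (m + 1) t) (at t)"
proof (cases t "0::real" rule: linorder_cases)
  case less
  have "((\<lambda>_. 0) has_real_derivative 0) (at t)" by simp
  then have "(flat m has_real_derivative 0) (at t)"
    by (rule has_field_derivative_transform_within_open[of _ _ _ "{..<0}"])
      (use less in \<open>auto simp: flat_def\<close>)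
  then show ?thesis using less by (simp add: flat_def)
next
  case equal
  have "(\<lambda>h. (flat m (0 + h) - flat m 0) / h) = flat (m + 1)"
    by (auto simp: flat_def fun_eq_iff)
  then show ?thesis using flat_tendsto_0[of "m + 1"]
    unfolding equal DERIV_def by (simp add: flat_def)
next
  case greater
  have pred: "t ^ k = t * t ^ (k - Suc 0)" if "k \<noteq> 0" for k
    using that by (cases k) auto
  have "((\<lambda>t. exp (- (1 / t)) / t ^ m) has_real_derivative
      flat (m + 2) t - real m * flat (m + 1) t) (at t)"
    using greater
    by (cases m; cases "m - 1")
      (auto intro!: derivative_eq_intros pred simp: flat_def field_simps power2_eq_square)
  then show ?thesis
    by (rule has_field_derivative_transform_within_open[of _ _ _ "{0<..}"])
      (use greater in \<open>auto simp: flat_def\<close>)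
qed

lemma k_times_cont_diff_flat:
  "k_times_cont_diff k (\<lambda>x::'a::euclidean_space. flat m (v \<bullet> x + d))"
proof (induction k arbitrary: m)
  case 0
  have "continuous_on UNIV (flat m)"
    by (meson DERIV_continuous_on DERIV_subset flat_has_derivative subset_UNIV)
  then show ?case
    by (auto intro!: continuous_on_compose2[of UNIV "flat m"] continuous_intros)
next
  case (Suc k)
  let ?D = "\<lambda>x. flat (m + 2) (v \<bullet> x + d) - real m * flat (m + 1) (v \<bullet> x + d)"
  have der: "((\<lambda>x. flat m (v \<bullet> x + d)) has_derivative (\<lambda>h. v \<bullet> h * ?D x)) (at x)" for x
  proof -
    have "((\<lambda>x. v \<bullet> x + d) has_derivative (\<lambda>h. v \<bullet> h)) (at x)"
      by (auto intro!: derivative_eq_intros)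
    from DERIV_compose_FDERIV[OF flat_has_derivative this]
    show ?thesis .
  qed
  have "partial b (\<lambda>x. flat m (v \<bullet> x + d)) = (\<lambda>x. v \<bullet> b * ?D x)" for b
    by (rule ext) (rule partial_eqI[OF der])
  then show ?case using der Suc.IH
    by (auto simp: differentiable_def intro!: k_times_cont_diff_mult k_times_cont_diff_diff k_times_cont_diff_const)
qed

text \<open>Since \<open>flat 0 (n * t) = exp (- 1 / (n * t))\<close> tends to \<open>1\<close> for every \<open>t > 0\<close>, letting \<open>n\<close> grow
  makes the bumps converge to the indicator of the box while their support stays the same. The
  factor \<open>Suc n\<close> avoids the degenerate case \<open>n = 0\<close>.\<close>

definition box_bump :: "'a::euclidean_space \<Rightarrow> 'a \<Rightarrow> nat \<Rightarrow> 'a \<Rightarrow> real" where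
  "box_bump a c n x = (\<Prod>b\<in>Basis. flat 0 (real (Suc n) * (x \<bullet> b - a \<bullet> b))
                                 * flat 0 (real (Suc n) * (c \<bullet> b - x \<bullet> b)))"

lemma box_bump_nonzero_iff: "box_bump a c n x \<noteq> 0 \<longleftrightarrow> x \<in> box a c"
  by (auto simp: box_bump_def flat_def mem_box zero_less_mult_iff)

lemma abs_box_bump_le: "\<bar>box_bump a c n x\<bar> \<le> indicator (box a c) x"
proof (cases "x \<in> box a c")
  case True
  have "0 \<le> flat 0 t \<and> flat 0 t \<le> 1" for t by (auto simp: flat_def)
  then have "\<bar>box_bump a c n x\<bar> \<le> 1"
    unfolding box_bump_def abs_prod by (intro prod_le_1) (auto simp: abs_mult intro!: mult_le_one)
  then show ?thesis using True by simp
qed (use box_bump_nonzero_iff in auto)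

lemma box_bump_tendsto: "(\<lambda>n. box_bump a c n x) \<longlonglongrightarrow> indicator (box a c) x"
proof (cases "x \<in> box a c")
  case True
  have *: "(\<lambda>n. flat 0 (real (Suc n) * s)) \<longlonglongrightarrow> 1" if "s > 0" for s
  proof -
    have "(\<lambda>n. exp (- (inverse (real (Suc n)) * (1 / s)))) \<longlonglongrightarrow> exp (- (0 * (1 / s)))"
      by (intro tendsto_intros LIMSEQ_inverse_real_of_nat)
    moreover have "flat 0 (real (Suc n) * s) = exp (- (inverse (real (Suc n)) * (1 / s)))" for n
      using that by (simp add: flat_def divide_simps)
    ultimately show ?thesis by simp
  qed
  have "(\<lambda>n. box_bump a c n x) \<longlonglongrightarrow> (\<Prod>b\<in>(Basis::'a set). 1 * 1)"
    unfolding box_bump_def using True by (intro tendsto_intros *) (auto simp: mem_box)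
  then show ?thesis using True by simp
next
  case False
  then have "box_bump a c n x = 0" for n using box_bump_nonzero_iff by blast
  then show ?thesis using False by simp
qed

lemma box_bump_test_function:
  assumes "cbox a c \<subseteq> \<Omega>"
  shows "box_bump a c n \<in> test_functions \<Omega>"
proof -
  have "flat 0 (real (Suc n) * (x \<bullet> b - a \<bullet> b)) = flat 0 ((real (Suc n) *\<^sub>R b) \<bullet> x + - real (Suc n) * (a \<bullet> b))"
    "flat 0 (real (Suc n) * (c \<bullet> b - x \<bullet> b)) = flat 0 ((- real (Suc n) *\<^sub>R b) \<bullet> x + real (Suc n) * (c \<bullet> b))"
    for x b by (simp_all add: algebra_simps inner_commute)
  then have "smooth (box_bump a c n)"
    unfolding smooth_def box_bump_def
    by (simp only:) (intro allI k_times_cont_diff_prod k_times_cont_diff_mult k_times_cont_diff_flat)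
  moreover have "{x. box_bump a c n x \<noteq> 0} = box a c" by (simp add: box_bump_nonzero_iff)
  moreover have "closure (box a c) \<subseteq> cbox a c"
    by (rule closure_minimal[OF box_subset_cbox closed_cbox])
  ultimately show ?thesis
    unfolding test_functions_def using assms by (auto simp: compact_closure)
qed

section \<open>The fundamental lemma of the calculus of variations\<close>

text \<open>Boxes form an intersection-stable generator of the Borel sets, and the sets over which \<open>h\<close>
  integrates to zero form a Dynkin system. The whole space belongs to it because it is an
  increasing union of boxes.\<close>

lemma AE_zero_if_box_integrals_zero:
  fixes h :: "'a::euclidean_space \<Rightarrow> real"
  assumes h: "integrable lborel h"
    and box: "\<And>a c. (LINT x:box a c|lborel. h x) = 0"
  shows "AE x in lborel. h x = 0"
proof -
  have set_int: "set_integrable lborel A h" if "A \<in> sets borel" for A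
    unfolding set_integrable_def using h that by (intro integrable_mult_indicator) auto
  have "(\<lambda>n. LINT x:box (- (real n *\<^sub>R One)) (real n *\<^sub>R One)|lborel. h x)
      \<longlonglongrightarrow> (LINT x:(\<Union>n. box (- (real n *\<^sub>R One)) (real n *\<^sub>R One))|lborel. h x)"
    by (rule set_integral_cont_up)
      (auto intro!: set_int subset_box_imp monoI simp: incseq_def)
  then have UNIV: "(LINT x:UNIV|lborel. h x) = 0"
    by (simp add: box UN_box_eq_UNIV LIMSEQ_const_iff)
  have "(LINT x:A|lborel. h x) = 0" if "A \<in> sets borel" for A
  proof -
    have "Int_stable (range (\<lambda>(a, b). box a b :: 'a set))"
      by (force intro!: Int_stableI simp: box_Int_box)
    moreover have "range (\<lambda>(a, b). box a b :: 'a set) \<subseteq> Pow UNIV" by simp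
    moreover have "A \<in> sigma_sets UNIV (range (\<lambda>(a, b). box a b))"
      using that by (simp add: borel_eq_box)
    ultimately show ?thesis
    proof (induction rule: sigma_sets_induct_disjoint)
      case (basic A)
      then show ?case using box by auto
    next
      case empty
      show ?case by (simp add: set_lebesgue_integral_def)
    next
      case (compl A)
      then have A: "A \<in> sets borel" by (simp add: borel_eq_box)
      have "(LINT x:A \<union> (UNIV - A)|lborel. h x) = (LINT x:A|lborel. h x) + (LINT x:UNIV - A|lborel. h x)"
        using A by (intro set_integral_Un set_int) auto
      then show ?case using compl UNIV by simp
    next
      case (union F)
      then have F: "\<And>i. F i \<in> sets borel" by (auto simp: borel_eq_box)
      have "(LINT x:(\<Union>i. F i)|lborel. h x) = (\<Sum>i. LINT x:F i|lborel. h x)"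
        using F union(1) by (intro lebesgue_integral_countable_add set_int)
          (auto simp: disjoint_family_on_def)
      then show ?case using union by simp
    qed
  qed
  then show ?thesis
    by (intro density_unique_real) (use h in \<open>auto simp: set_lebesgue_integral_def\<close>)
qed

text \<open>Inserting the bumps on a box compactly contained in \<open>\<Omega>\<close> and passing to the limit by
  dominated convergence shows that \<open>h\<close> integrates to zero over every such box. Cut off to one box,
  \<open>h\<close> becomes integrable on the whole space and has vanishing integrals over all boxes, because
  boxes intersect in boxes; so it vanishes almost everywhere there. Countably many closed boxes,
  whose frontiers are null sets, exhaust \<open>\<Omega>\<close>.\<close>

lemma fundamental_lemma_calculus_of_variations:
  fixes h :: "'a::euclidean_space \<Rightarrow> real"
  assumes "open \<Omega>"
    and h: "h \<in> borel_measurable (lebesgue_on \<Omega>)"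
    and loc: "\<And>a c. cbox a c \<subseteq> \<Omega> \<Longrightarrow> integrable (lebesgue_on \<Omega>) (\<lambda>x. indicator (box a c) x * h x)"
    and orth: "\<And>\<theta>. \<theta> \<in> test_functions \<Omega> \<Longrightarrow> (LINT x|lebesgue_on \<Omega>. h x * \<theta> x) = 0"
  shows "AE x in lebesgue_on \<Omega>. h x = 0"
proof -
  have \<Omega>: "\<Omega> \<inter> space lebesgue \<in> sets lebesgue" using \<open>open \<Omega>\<close> by auto
  have box0: "(LINT x|lebesgue_on \<Omega>. indicator (box a c) x * h x) = 0" if ac: "cbox a c \<subseteq> \<Omega>" for a c
  proof -
    have bump: "box_bump a c n \<in> borel_measurable (lebesgue_on \<Omega>)" for n
    proof -
      have "continuous_on UNIV (box_bump a c n)"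
        using box_bump_test_function[OF ac] k_times_cont_diff_continuous
        unfolding test_functions_def smooth_def by blast
      then show ?thesis
        by (intro measurable_restrict_space1 measurable_completion) (simp add: borel_measurable_continuous_onI)
    qed
    have "(\<lambda>n. LINT x|lebesgue_on \<Omega>. h x * box_bump a c n x)
        \<longlonglongrightarrow> (LINT x|lebesgue_on \<Omega>. h x * indicator (box a c) x)"
    proof (rule integral_dominated_convergence[where w = "\<lambda>x. \<bar>indicator (box a c) x * h x\<bar>"])
      show "(\<lambda>x. h x * indicator (box a c) x) \<in> borel_measurable (lebesgue_on \<Omega>)"
        using borel_measurable_integrable[OF loc[OF ac]] by (simp add: mult.commute)
      show "integrable (lebesgue_on \<Omega>) (\<lambda>x. \<bar>indicator (box a c) x * h x\<bar>)"
        using loc[OF ac] by (rule integrable_abs)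
      show "AE x in lebesgue_on \<Omega>. norm (h x * box_bump a c n x) \<le> \<bar>indicator (box a c) x * h x\<bar>" for n
        using mult_left_mono[OF abs_box_bump_le abs_ge_zero] by (auto simp: abs_mult mult.commute intro!: AE_I2)
    qed (use h bump in \<open>auto intro!: tendsto_intros box_bump_tendsto\<close>)
    then show ?thesis
      using orth box_bump_test_function[OF ac] by (simp add: LIMSEQ_const_iff mult.commute)
  qed
  have on_cbox: "AE x in lebesgue. x \<in> cbox a c \<longrightarrow> h x = 0" if ac: "cbox a c \<subseteq> \<Omega>" for a c
  proof -
    define H where "H = (\<lambda>x. indicator \<Omega> x * (indicator (box a c) x * h x))"
    have H: "integrable lebesgue H"
      using loc[OF ac] unfolding H_def integrable_restrict_space[OF \<Omega>] by simp
    \<comment> \<open>The Dynkin argument lives on Borel sets, hence the passage to a Borel representative.\<close>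
    obtain H' where H': "H' \<in> borel_measurable lborel" and HH': "AE x in lebesgue. H x = H' x"
      using completion_ex_borel_measurable_real[OF borel_measurable_integrable[OF H]]
      by (auto simp: AE_completion_iff intro: AE_completion)
    have "integrable lebesgue H'"
      by (rule integrable_cong_AE_imp[OF H]) (use HH' H' in \<open>auto intro: measurable_completion\<close>)
    then have "integrable lborel H'" using H' by (simp add: integrable_completion)
    moreover have "(LINT x:box a' c'|lborel. H' x) = 0" for a' c'
    proof -
      let ?l = "\<Sum>i\<in>Basis. max (a \<bullet> i) (a' \<bullet> i) *\<^sub>R i" and ?u = "\<Sum>i\<in>Basis. min (c \<bullet> i) (c' \<bullet> i) *\<^sub>R i"
      have Int: "box a c \<inter> box a' c' = box ?l ?u" "cbox ?l ?u \<subseteq> \<Omega>"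
        using ac by (auto simp: box_Int_box simp flip: Int_interval)
      have "(LINT x:box a' c'|lborel. H' x) = (LINT x|lebesgue. indicator (box a' c') x * H' x)"
        unfolding set_lebesgue_integral_def
        using H' by (subst integral_completion) auto
      also have "\<dots> = (LINT x|lebesgue. indicator (box a' c') x * H x)"
      proof (rule integral_cong_AE)
        show "(\<lambda>x. indicator (box a' c') x * H' x) \<in> borel_measurable lebesgue"
          using H' by (intro measurable_completion) simp
        have "(indicator (box a' c') :: 'a \<Rightarrow> real) \<in> borel_measurable lebesgue"
          by (intro measurable_completion) simp
        then show "(\<lambda>x. indicator (box a' c') x * H x) \<in> borel_measurable lebesgue"
          using borel_measurable_integrable[OF H] by (rule borel_measurable_times)
      qed (use HH' in auto)
      also have "\<dots> = (LINT x|lebesgue. indicator \<Omega> x *\<^sub>R (indicator (box ?l ?u) x * h x))"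
        unfolding H_def Int(1)[symmetric] by (intro Bochner_Integration.integral_cong) (auto simp: indicator_def)
      also have "\<dots> = 0"
        using box0[OF Int(2)] unfolding integral_restrict_space[OF \<Omega>] .
      finally show ?thesis .
    qed
    ultimately have "AE x in lborel. H' x = 0" by (rule AE_zero_if_box_integrals_zero)
    then have "AE x in lebesgue. H' x = 0" by (rule AE_completion)
    moreover have "AE x in lebesgue. x \<notin> cbox a c - box a c"
      using negligible_frontier_interval[of a c] unfolding negligible_iff_null_sets by (rule AE_not_in)
    ultimately show ?thesis using HH'
    proof eventually_elim
      fix x assume *: "H' x = 0" "x \<notin> cbox a c - box a c" "H x = H' x"
      show "x \<in> cbox a c \<longrightarrow> h x = 0"
      proof
        assume "x \<in> cbox a c"
        then have "x \<in> box a c" "x \<in> \<Omega>" using *(2) ac by auto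
        then show "h x = 0" using *(1,3) by (simp add: H_def)
      qed
    qed
  qed
  obtain \<D> where \<D>: "countable \<D>" "\<D> \<subseteq> Pow \<Omega>" "\<And>X. X \<in> \<D> \<Longrightarrow> \<exists>a c. X = cbox a c" "\<Union>\<D> = \<Omega>"
    using open_countable_Union_open_cbox[OF \<open>open \<Omega>\<close>] by metis
  have "\<forall>X\<in>\<D>. AE x in lebesgue. x \<in> X \<longrightarrow> h x = 0"
  proof
    fix X assume "X \<in> \<D>"
    then obtain a c where "X = cbox a c" using \<D>(3) by blast
    moreover have "X \<subseteq> \<Omega>" using \<open>X \<in> \<D>\<close> \<D>(2) by blast
    ultimately show "AE x in lebesgue. x \<in> X \<longrightarrow> h x = 0" using on_cbox by simp
  qed
  then have "AE x in lebesgue. \<forall>X\<in>\<D>. x \<in> X \<longrightarrow> h x = 0"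
    using \<D>(1) by (subst AE_ball_countable)
  then have "AE x in lebesgue. x \<in> \<Omega> \<longrightarrow> h x = 0"
    by eventually_elim (use \<D>(4) in blast)
  then show ?thesis by (simp add: AE_restrict_space_iff[OF \<Omega>])
qed

section \<open>Square integrable functions\<close>

definition L2_inner :: "'a::euclidean_space set \<Rightarrow> ('a \<Rightarrow> 'b::euclidean_space) \<Rightarrow> ('a \<Rightarrow> 'b) \<Rightarrow> real" where
  "L2_inner \<Omega> f g = (LINT x|lebesgue_on \<Omega>. f x \<bullet> g x)"

lemma L2_measurable: "f \<in> L2 \<Omega> \<Longrightarrow> f \<in> borel_measurable (lebesgue_on \<Omega>)"
  and L2_integrable: "f \<in> L2 \<Omega> \<Longrightarrow> integrable (lebesgue_on \<Omega>) (\<lambda>x. (norm (f x))\<^sup>2)"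
  by (simp_all add: L2_def)

lemma L2_integrable_inner:
  assumes f: "f \<in> L2 \<Omega>" and g: "g \<in> L2 \<Omega>"
  shows "integrable (lebesgue_on \<Omega>) (\<lambda>x. f x \<bullet> g x)"
proof (rule Bochner_Integration.integrable_bound)
  show "integrable (lebesgue_on \<Omega>) (\<lambda>x. (norm (f x))\<^sup>2 + (norm (g x))\<^sup>2)"
    using f g by (simp add: L2_def)
  show "(\<lambda>x. f x \<bullet> g x) \<in> borel_measurable (lebesgue_on \<Omega>)"
    using f g by (intro borel_measurable_inner) (simp_all add: L2_def)
  have "\<bar>f x \<bullet> g x\<bar> \<le> (norm (f x))\<^sup>2 + (norm (g x))\<^sup>2" for x
  proof -
    have "\<bar>f x \<bullet> g x\<bar> \<le> norm (f x) * norm (g x)" by (rule Cauchy_Schwarz_ineq2)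
    also have "2 * \<dots> \<le> (norm (f x))\<^sup>2 + (norm (g x))\<^sup>2"
      using sum_squares_bound[of "norm (f x)" "norm (g x)"] by simp
    finally have "2 * \<bar>f x \<bullet> g x\<bar> \<le> (norm (f x))\<^sup>2 + (norm (g x))\<^sup>2" by simp
    then show ?thesis by simp
  qed
  then show "AE x in lebesgue_on \<Omega>. norm (f x \<bullet> g x) \<le> norm ((norm (f x))\<^sup>2 + (norm (g x))\<^sup>2)"
    by simp
qed

lemma L2_diff:
  assumes f: "f \<in> L2 \<Omega>" and g: "g \<in> L2 \<Omega>"
  shows "(\<lambda>x. f x - g x) \<in> L2 \<Omega>"
proof -
  have "integrable (lebesgue_on \<Omega>) (\<lambda>x. (norm (f x))\<^sup>2 + (norm (g x))\<^sup>2 - 2 * (f x \<bullet> g x))"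
    using f g by (simp add: L2_integrable L2_integrable_inner)
  moreover have "(norm (f x - g x))\<^sup>2 = (norm (f x))\<^sup>2 + (norm (g x))\<^sup>2 - 2 * (f x \<bullet> g x)" for x
    by (simp add: power2_norm_eq_inner inner_commute algebra_simps)
  ultimately show ?thesis using f g by (simp add: L2_def borel_measurable_diff)
qed

lemma L2_component:
  assumes "f \<in> L2 \<Omega>" shows "(\<lambda>x. f x \<bullet> b) \<in> L2 \<Omega>"
proof -
  have m: "(\<lambda>x. f x \<bullet> b) \<in> borel_measurable (lebesgue_on \<Omega>)"
    using L2_measurable[OF assms] by measurable
  have "integrable (lebesgue_on \<Omega>) (\<lambda>x. (norm (f x \<bullet> b))\<^sup>2)"
  proof (rule Bochner_Integration.integrable_bound)
    show "integrable (lebesgue_on \<Omega>) (\<lambda>x. (norm b)\<^sup>2 * (norm (f x))\<^sup>2)"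
      using L2_integrable[OF assms] by simp
    have "\<bar>f x \<bullet> b\<bar>\<^sup>2 \<le> (norm b)\<^sup>2 * (norm (f x))\<^sup>2" for x
      using power_mono[OF Cauchy_Schwarz_ineq2[of "f x" b], of 2] by (simp add: power_mult_distrib mult.commute)
    then show "AE x in lebesgue_on \<Omega>. norm ((norm (f x \<bullet> b))\<^sup>2) \<le> norm ((norm b)\<^sup>2 * (norm (f x))\<^sup>2)"
      by simp
  qed (use m in measurable)
  with m show ?thesis by (simp add: L2_def)
qed

lemma L2_norm_nonneg: "0 \<le> L2_norm \<Omega> f"
  by (simp add: L2_norm_def)

lemma L2_norm_power2: "(L2_norm \<Omega> f)\<^sup>2 = L2_inner \<Omega> f f"
  by (simp add: L2_norm_def L2_inner_def power2_norm_eq_inner)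

lemma L2_norm_cong_AE:
  assumes "f \<in> L2 \<Omega>" "g \<in> L2 \<Omega>" "AE x in lebesgue_on \<Omega>. f x = g x"
  shows "L2_norm \<Omega> f = L2_norm \<Omega> g"
  unfolding L2_norm_def using assms
  by (intro arg_cong[where f = sqrt] integral_cong_AE) (auto simp: L2_def)

lemma L2_inner_cong_AE:
  assumes "f \<in> L2 \<Omega>" "f' \<in> L2 \<Omega>" "g \<in> L2 \<Omega>" "AE x in lebesgue_on \<Omega>. f x = f' x"
  shows "L2_inner \<Omega> f g = L2_inner \<Omega> f' g"
  unfolding L2_inner_def using assms
  by (intro integral_cong_AE) (auto intro: borel_measurable_inner L2_measurable)

lemma L2_inner_diff_left:
  assumes "f \<in> L2 \<Omega>" "g \<in> L2 \<Omega>" "h \<in> L2 \<Omega>"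
  shows "L2_inner \<Omega> (\<lambda>x. f x - g x) h = L2_inner \<Omega> f h - L2_inner \<Omega> g h"
  using assms by (simp add: L2_inner_def inner_diff_left L2_integrable_inner)

lemma L2_norm_diff_power2:
  assumes "f \<in> L2 \<Omega>" "g \<in> L2 \<Omega>"
  shows "(L2_norm \<Omega> (\<lambda>x. f x - g x))\<^sup>2 = (L2_norm \<Omega> f)\<^sup>2 + (L2_norm \<Omega> g)\<^sup>2 - 2 * L2_inner \<Omega> f g"
proof -
  have "(f x - g x) \<bullet> (f x - g x) = f x \<bullet> f x + g x \<bullet> g x - 2 * (f x \<bullet> g x)" for x
    by (simp add: inner_commute algebra_simps)
  then show ?thesis
    using assms by (simp add: L2_norm_power2 L2_inner_def L2_integrable_inner)
qed

text \<open>The quadratic polynomial \<open>s \<mapsto> \<parallel>f - s g\<parallel>\<^sup>2\<close> is nonnegative. If its leading coefficient is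
  positive, evaluating it at its minimum gives the claim; otherwise it is affine, hence constant.\<close>

lemma L2_Cauchy_Schwarz:
  assumes "f \<in> L2 \<Omega>" "g \<in> L2 \<Omega>"
  shows "\<bar>L2_inner \<Omega> f g\<bar> \<le> L2_norm \<Omega> f * L2_norm \<Omega> g"
proof -
  let ?A = "(L2_norm \<Omega> f)\<^sup>2" and ?B = "(L2_norm \<Omega> g)\<^sup>2" and ?I = "L2_inner \<Omega> f g"
  have quad: "0 \<le> ?A - 2 * s * ?I + s\<^sup>2 * ?B" for s
  proof -
    have "(f x - s *\<^sub>R g x) \<bullet> (f x - s *\<^sub>R g x) = f x \<bullet> f x - 2 * s * (f x \<bullet> g x) + s\<^sup>2 * (g x \<bullet> g x)" for x
      by (simp add: inner_commute algebra_simps power2_eq_square)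
    then have "(LINT x|lebesgue_on \<Omega>. (f x - s *\<^sub>R g x) \<bullet> (f x - s *\<^sub>R g x)) = ?A - 2 * s * ?I + s\<^sup>2 * ?B"
      using assms by (simp add: L2_norm_power2 L2_inner_def L2_integrable_inner)
    moreover have "0 \<le> (LINT x|lebesgue_on \<Omega>. (f x - s *\<^sub>R g x) \<bullet> (f x - s *\<^sub>R g x))" by simp
    ultimately show ?thesis by simp
  qed
  have "?I\<^sup>2 \<le> ?A * ?B"
  proof (cases "?B = 0")
    case True
    have "?I = 0"
    proof (rule ccontr)
      assume "?I \<noteq> 0"
      \<comment> \<open>At this point the affine function takes the value \<open>-1\<close>.\<close>
      then show False using quad[of "(?A + 1) / (2 * ?I)"] True by simp
    qed
    then show ?thesis by simp
  next
    case False
    then have "?B > 0" by simp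
    moreover have "I\<^sup>2 \<le> A * B" if "B > 0" "0 \<le> A - 2 * (I / B) * I + (I / B)\<^sup>2 * B" for A B I :: real
      using that by (simp add: field_simps power2_eq_square)
    ultimately show ?thesis using quad[of "?I / ?B"] by blast
  qed
  then have "\<bar>?I\<bar>\<^sup>2 \<le> (L2_norm \<Omega> f * L2_norm \<Omega> g)\<^sup>2"
    by (simp add: power_mult_distrib)
  then show ?thesis
    by (rule power2_le_imp_le) (simp add: L2_norm_nonneg)
qed

lemma L2_norm_diff_le:
  assumes "f \<in> L2 \<Omega>" "g \<in> L2 \<Omega>"
  shows "L2_norm \<Omega> (\<lambda>x. f x - g x) \<le> L2_norm \<Omega> f + L2_norm \<Omega> g"
proof (rule power2_le_imp_le)
  show "(L2_norm \<Omega> (\<lambda>x. f x - g x))\<^sup>2 \<le> (L2_norm \<Omega> f + L2_norm \<Omega> g)\<^sup>2"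
    using L2_Cauchy_Schwarz[OF assms] by (simp add: L2_norm_diff_power2[OF assms] power2_sum abs_le_iff)
qed (simp add: L2_norm_nonneg)

lemma L2_if_continuous_compact_support:
  fixes f :: "'a::euclidean_space \<Rightarrow> 'b::euclidean_space"
  assumes "open \<Omega>" and f: "continuous_on UNIV f" and K: "compact K" "\<And>x. x \<notin> K \<Longrightarrow> f x = 0"
  shows "f \<in> L2 \<Omega>"
proof -
  have "integrable lborel (\<lambda>x. indicator K x *\<^sub>R (norm (f x))\<^sup>2)"
    using K(1) by (rule borel_integrable_compact) (intro continuous_intros continuous_on_subset[OF f], simp)
  moreover have "(\<lambda>x. indicator K x *\<^sub>R (norm (f x))\<^sup>2) = (\<lambda>x. (norm (f x))\<^sup>2)"
    using K(2) by (intro ext) (auto simp: indicator_def)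
  moreover have m: "f \<in> borel_measurable borel" using f by (rule borel_measurable_continuous_onI)
  ultimately have "integrable lebesgue (\<lambda>x. (norm (f x))\<^sup>2)"
    by (subst integrable_completion) auto
  then have "integrable (lebesgue_on \<Omega>) (\<lambda>x. (norm (f x))\<^sup>2)"
    using \<open>open \<Omega>\<close> integrable_mult_indicator[of \<Omega> lebesgue "\<lambda>x. (norm (f x))\<^sup>2"]
    by (subst integrable_restrict_space) auto
  moreover have "f \<in> borel_measurable (lebesgue_on \<Omega>)"
    using m by (intro measurable_restrict_space1 measurable_completion) simp
  ultimately show ?thesis by (simp add: L2_def)
qed

text \<open>Square integrable functions are locally integrable, being integrable against the square
  integrable indicator of a box.\<close>

lemma AE_zero_if_L2_orthogonal_test_functions:
  fixes h :: "'a::euclidean_space \<Rightarrow> real"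
  assumes "open \<Omega>" and h: "h \<in> L2 \<Omega>"
    and orth: "\<And>\<theta>. \<theta> \<in> test_functions \<Omega> \<Longrightarrow> (LINT x|lebesgue_on \<Omega>. h x * \<theta> x) = 0"
  shows "AE x in lebesgue_on \<Omega>. h x = 0"
proof (rule fundamental_lemma_calculus_of_variations[OF \<open>open \<Omega>\<close> L2_measurable[OF h] _ orth])
  fix a c :: 'a
  have "integrable lborel (indicator (box a c) :: 'a \<Rightarrow> real)"
    using emeasure_lborel_box_finite[of a c] by (simp add: integrable_indicator_iff)
  then have "integrable lebesgue (indicator (box a c) :: 'a \<Rightarrow> real)"
    by (subst integrable_completion) auto
  then have "integrable (lebesgue_on \<Omega>) (indicator (box a c) :: 'a \<Rightarrow> real)"
    using \<open>open \<Omega>\<close> integrable_mult_indicator[of \<Omega> lebesgue "indicator (box a c) :: 'a \<Rightarrow> real"]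
    by (subst integrable_restrict_space) auto
  moreover have "(\<lambda>x. (norm (indicator (box a c) x :: real))\<^sup>2) = indicator (box a c)"
    by (auto simp: indicator_def)
  ultimately have "(indicator (box a c) :: 'a \<Rightarrow> real) \<in> L2 \<Omega>"
    by (auto simp: L2_def dest: borel_measurable_integrable)
  from L2_integrable_inner[OF this h]
  show "integrable (lebesgue_on \<Omega>) (\<lambda>x. indicator (box a c) x * h x)" by simp
qed

section \<open>Test functions and integration by parts\<close>

lemma test_function_differentiable: "\<theta> \<in> test_functions \<Omega> \<Longrightarrow> \<theta> differentiable (at x)"
  unfolding test_functions_def smooth_def using k_times_cont_diff.simps(2) by blast

lemma test_function_continuous: "\<theta> \<in> test_functions \<Omega> \<Longrightarrow> continuous_on UNIV \<theta>"
  unfolding test_functions_def smooth_def using k_times_cont_diff_continuous by blast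

lemma test_function_partial_continuous:
  "\<theta> \<in> test_functions \<Omega> \<Longrightarrow> b \<in> Basis \<Longrightarrow> continuous_on UNIV (partial b \<theta>)"
  unfolding test_functions_def smooth_def
  using k_times_cont_diff.simps(2) k_times_cont_diff_continuous by blast

lemma partial_zero_outside_support:
  assumes "x \<notin> closure {x. \<theta> x \<noteq> 0}"
  shows "partial b \<theta> x = 0"
proof -
  have "((\<lambda>_. 0) has_derivative (\<lambda>_. 0)) (at x)" by simp
  then have "(\<theta> has_derivative (\<lambda>_. 0)) (at x)"
    by (rule has_derivative_transform_within_open[of _ _ _ _ "- closure {x. \<theta> x \<noteq> 0}"])
      (use assms closure_subset[of "{x. \<theta> x \<noteq> 0}"] in auto)
  then show ?thesis by (rule partial_eqI)
qed

lemma test_function_supportE: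
  assumes "\<theta> \<in> test_functions \<Omega>"
  obtains K where "compact K" "K \<subseteq> \<Omega>" "\<And>x. x \<notin> K \<Longrightarrow> \<theta> x = 0" "\<And>b x. x \<notin> K \<Longrightarrow> partial b \<theta> x = 0"
proof (rule that[of "closure {x. \<theta> x \<noteq> 0}"])
  fix x assume "x \<notin> closure {x. \<theta> x \<noteq> 0}"
  then show "\<theta> x = 0" using closure_subset[of "{x. \<theta> x \<noteq> 0}"] by blast
qed (use assms partial_zero_outside_support in \<open>auto simp: test_functions_def\<close>)

lemma test_functions_supportI:
  assumes "smooth \<theta>" "compact K" "K \<subseteq> \<Omega>" "\<And>x. x \<notin> K \<Longrightarrow> \<theta> x = 0"
  shows "\<theta> \<in> test_functions \<Omega>"
proof -
  have "closure {x. \<theta> x \<noteq> 0} \<subseteq> K"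
    using assms by (intro closure_minimal compact_imp_closed) auto
  then show ?thesis
    using assms unfolding test_functions_def
    by (auto simp: compact_eq_bounded_closed intro: bounded_subset)
qed

lemma test_function_mult:
  assumes "\<theta> \<in> test_functions \<Omega>" "\<eta> \<in> test_functions \<Omega>"
  shows "(\<lambda>x. \<theta> x * \<eta> x) \<in> test_functions \<Omega>"
proof -
  obtain K where "compact K" "K \<subseteq> \<Omega>" "\<And>x. x \<notin> K \<Longrightarrow> \<theta> x = 0"
    using test_function_supportE[OF assms(1)] by metis
  with assms show ?thesis
    by (intro test_functions_supportI[of _ K])
      (auto simp: test_functions_def smooth_def intro: k_times_cont_diff_mult)
qed

lemma test_function_diff:
  assumes "\<theta> \<in> test_functions \<Omega>" "\<eta> \<in> test_functions \<Omega>"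
  shows "(\<lambda>x. \<theta> x - \<eta> x) \<in> test_functions \<Omega>"
proof -
  obtain K where "compact K" "K \<subseteq> \<Omega>" "\<And>x. x \<notin> K \<Longrightarrow> \<theta> x = 0"
    using test_function_supportE[OF assms(1)] by metis
  moreover obtain L where "compact L" "L \<subseteq> \<Omega>" "\<And>x. x \<notin> L \<Longrightarrow> \<eta> x = 0"
    using test_function_supportE[OF assms(2)] by metis
  ultimately show ?thesis using assms
    by (intro test_functions_supportI[of _ "K \<union> L"])
      (auto simp: test_functions_def smooth_def intro: k_times_cont_diff_diff compact_Un)
qed

lemma gradient_inner_Basis: "b \<in> Basis \<Longrightarrow> gradient \<theta> x \<bullet> b = partial b \<theta> x"
  by (simp add: gradient_def)

lemma test_function_L2:
  assumes "open \<Omega>" "\<theta> \<in> test_functions \<Omega>"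
  shows "\<theta> \<in> L2 \<Omega>" and "b \<in> Basis \<Longrightarrow> partial b \<theta> \<in> L2 \<Omega>" and "gradient \<theta> \<in> L2 \<Omega>"
proof -
  obtain K where K: "compact K" "\<And>x. x \<notin> K \<Longrightarrow> \<theta> x = 0" "\<And>b x. x \<notin> K \<Longrightarrow> partial b \<theta> x = 0"
    using test_function_supportE[OF assms(2)] by metis
  show "\<theta> \<in> L2 \<Omega>"
    using assms K by (intro L2_if_continuous_compact_support[of _ _ K] test_function_continuous) auto
  show "partial b \<theta> \<in> L2 \<Omega>" if "b \<in> Basis"
    using assms K that
    by (intro L2_if_continuous_compact_support[of _ _ K] test_function_partial_continuous) auto
  have "continuous_on UNIV (gradient \<theta>)"
    unfolding gradient_def using test_function_partial_continuous[OF assms(2)]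
    by (intro continuous_intros) auto
  then show "gradient \<theta> \<in> L2 \<Omega>"
    using assms K by (intro L2_if_continuous_compact_support[of _ _ K]) (auto simp: gradient_def)
qed

lemma integral_lebesgue_on_eq_lborel:
  fixes f :: "'a::euclidean_space \<Rightarrow> real"
  assumes "open \<Omega>" "continuous_on UNIV f" "\<And>x. x \<notin> \<Omega> \<Longrightarrow> f x = 0"
  shows "(LINT x|lebesgue_on \<Omega>. f x) = (LINT x|lborel. f x)"
proof -
  have "(LINT x|lebesgue_on \<Omega>. f x) = (LINT x|lebesgue. indicator \<Omega> x *\<^sub>R f x)"
    using assms(1) by (intro integral_restrict_space) auto
  also have "(\<lambda>x. indicator \<Omega> x *\<^sub>R f x) = f"
    using assms(3) by (intro ext) (auto simp: indicator_def)
  finally show ?thesis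
    using borel_measurable_continuous_onI[OF assms(2)] by (simp add: integral_completion)
qed

text \<open>The integral of a difference quotient of \<open>F\<close> in the direction \<open>b\<close> vanishes by the
  translation invariance of Lebesgue measure. The quotients converge to the partial derivative,
  and they are dominated because, by the mean value theorem, they are bounded by the supremum of
  that derivative, and they vanish outside a fixed ball.\<close>

lemma integral_partial_eq_0:
  fixes F :: "'a::euclidean_space \<Rightarrow> real"
  assumes F: "F \<in> test_functions \<Omega>" and b: "b \<in> Basis"
  shows "(LINT x|lborel. partial b F x) = 0"
proof -
  obtain K where K: "compact K" "\<And>x. x \<notin> K \<Longrightarrow> F x = 0" "\<And>b x. x \<notin> K \<Longrightarrow> partial b F x = 0"
    using test_function_supportE[OF F] by metis
  note cont = test_function_continuous[OF F] and dcont = test_function_partial_continuous[OF F b]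
  note [measurable] = borel_measurable_continuous_onI[OF cont] borel_measurable_continuous_onI[OF dcont]
  have intF: "integrable lborel F"
  proof -
    have "integrable lborel (\<lambda>x. indicator K x *\<^sub>R F x)"
      using K(1) by (rule borel_integrable_compact) (rule continuous_on_subset[OF cont], simp)
    moreover have "(\<lambda>x. indicator K x *\<^sub>R F x) = F"
      using K(2) by (intro ext) (auto simp: indicator_def)
    ultimately show ?thesis by simp
  qed
  have shift: "integrable lborel (\<lambda>x. F (v + x))" "(LINT x|lborel. F (v + x)) = (LINT x|lborel. F x)" for v
  proof -
    have "integrable (distr lborel borel ((+) v)) F" using intF by (simp add: lborel_distr_plus)
    then show "integrable lborel (\<lambda>x. F (v + x))" by (subst (asm) integrable_distr_eq) auto
    have "(LINT x|distr lborel borel ((+) v). F x) = (LINT x|lborel. F (v + x))"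
      by (rule integral_distr) auto
    then show "(LINT x|lborel. F (v + x)) = (LINT x|lborel. F x)" by (simp add: lborel_distr_plus)
  qed
  have line: "((\<lambda>t. F (t *\<^sub>R b + x)) has_real_derivative partial b F (t *\<^sub>R b + x)) (at t)" for t x
  proof -
    have "((\<lambda>t. t *\<^sub>R b + x) has_derivative (\<lambda>h. h *\<^sub>R b)) (at t)"
      by (auto intro!: derivative_eq_intros)
    from has_derivative_compose[OF this partial_has_derivative[OF test_function_differentiable[OF F]]]
    have "((\<lambda>t. F (t *\<^sub>R b + x)) has_derivative (\<lambda>h. partial (h *\<^sub>R b) F (t *\<^sub>R b + x))) (at t)" .
    moreover have "partial (h *\<^sub>R b) F y = partial b F y * h" for h y
      using linear_frechet_derivative[OF test_function_differentiable[OF F]]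
      by (simp add: partial_def linear_scale)
    ultimately show ?thesis by (simp add: has_field_derivative_def)
  qed
  obtain C where C: "\<And>x. \<bar>partial b F x\<bar> \<le> C"
  proof -
    have "bounded (partial b F ` K)"
      using K(1) by (intro compact_imp_bounded compact_continuous_image continuous_on_subset[OF dcont]) auto
    then obtain C where "0 < C" "\<And>x. x \<in> K \<Longrightarrow> \<bar>partial b F x\<bar> \<le> C"
      by (auto simp: bounded_pos)
    then show thesis using K(3) by (intro that[of C]) (metis abs_zero less_imp_le)
  qed
  \<comment> \<open>Steps of length at most \<open>1\<close> keep the supports of all quotients in one ball.\<close>
  define D where "D n x = (F (inverse (real (Suc n)) *\<^sub>R b + x) - F x) / inverse (real (Suc n))" for n x
  obtain R where R: "\<And>x. x \<in> K \<Longrightarrow> norm x \<le> R"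
    using compact_imp_bounded[OF K(1)] by (auto simp: bounded_iff)
  have D_bound: "\<bar>D n x\<bar> \<le> indicator (cball 0 (R + 1)) x * C" for n x
  proof (cases "x \<in> cball 0 (R + 1)")
    case True
    let ?h = "inverse (real (Suc n))"
    have "0 < ?h" by simp
    then obtain z where "F (?h *\<^sub>R b + x) - F (0 *\<^sub>R b + x) = (?h - 0) * partial b F (z *\<^sub>R b + x)"
      using MVT2[of 0 ?h "\<lambda>t. F (t *\<^sub>R b + x)" "\<lambda>t. partial b F (t *\<^sub>R b + x)"] line by blast
    then have "D n x = partial b F (z *\<^sub>R b + x)" by (simp add: D_def)
    then show ?thesis using True C by simp
  next
    case False
    have "x \<notin> K" using R[of x] False by auto
    moreover have "norm x \<le> norm (inverse (real (Suc n)) *\<^sub>R b + x) + norm (inverse (real (Suc n)) *\<^sub>R b)"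
      using norm_triangle_ineq4[of "inverse (real (Suc n)) *\<^sub>R b + x" "inverse (real (Suc n)) *\<^sub>R b"] by simp
    moreover have "norm (inverse (real (Suc n)) *\<^sub>R b) \<le> 1"
      using b by (simp add: inverse_le_1_iff)
    ultimately have "inverse (real (Suc n)) *\<^sub>R b + x \<notin> K"
      using R[of "inverse (real (Suc n)) *\<^sub>R b + x"] False by auto
    then show ?thesis using \<open>x \<notin> K\<close> False K(2) by (simp add: D_def)
  qed
  have "(\<lambda>n. LINT x|lborel. D n x) \<longlonglongrightarrow> (LINT x|lborel. partial b F x)"
  proof (rule integral_dominated_convergence)
    have "integrable lborel (indicator (cball 0 (R + 1)) :: 'a \<Rightarrow> real)"
      using emeasure_bounded_finite[of "cball (0::'a) (R + 1)"] by (simp add: integrable_indicator_iff)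
    then show "integrable lborel (\<lambda>x::'a. indicator (cball 0 (R + 1)) x * C)" by simp
    show "AE x in lborel. norm (D n x) \<le> indicator (cball 0 (R + 1)) x * C" for n
      using D_bound by simp
    have "(\<lambda>n. D n x) \<longlonglongrightarrow> partial b F x" for x
    proof -
      have "((\<lambda>h. (F (h *\<^sub>R b + x) - F x) / h) \<longlongrightarrow> partial b F x) (at 0)"
        using line[of x 0] by (simp add: DERIV_def)
      moreover have "filterlim (\<lambda>n. inverse (real (Suc n))) (at 0) sequentially"
        using LIMSEQ_inverse_real_of_nat by (simp add: filterlim_at)
      ultimately show ?thesis unfolding D_def by (rule filterlim_compose)
    qed
    then show "AE x in lborel. (\<lambda>n. D n x) \<longlonglongrightarrow> partial b F x" by simp
  qed (auto simp: D_def)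
  moreover have "(LINT x|lborel. D n x) = 0" for n
    unfolding D_def using shift intF by simp
  ultimately show ?thesis by (simp add: LIMSEQ_const_iff)
qed

text \<open>This is integration by parts: the partial derivative of the product of two test functions
  has integral zero.\<close>

lemma test_function_is_weak_gradient:
  assumes "open \<Omega>" and \<theta>: "\<theta> \<in> test_functions \<Omega>"
  shows "is_weak_gradient \<Omega> \<theta> (gradient \<theta>)"
  unfolding is_weak_gradient_def
proof (intro ballI)
  fix \<eta> and b :: 'a assume \<eta>: "\<eta> \<in> test_functions \<Omega>" and b: "b \<in> Basis"
  have prod: "partial b (\<lambda>x. \<theta> x * \<eta> x) = (\<lambda>x. \<theta> x * partial b \<eta> x + partial b \<theta> x * \<eta> x)"
    using test_function_differentiable[OF \<theta>] test_function_differentiable[OF \<eta>]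
    by (auto simp: partial_mult)
  have outside: "\<eta> x = 0 \<and> partial b \<eta> x = 0" if "x \<notin> \<Omega>" for x
    using test_function_supportE[OF \<eta>] that by (metis subsetD)
  have "(LINT x|lebesgue_on \<Omega>. \<theta> x * partial b \<eta> x + partial b \<theta> x * \<eta> x) = 0"
    using integral_partial_eq_0[OF test_function_mult[OF \<theta> \<eta>] b] outside
    unfolding prod
    by (subst integral_lebesgue_on_eq_lborel[OF \<open>open \<Omega>\<close>])
      (auto intro!: continuous_intros test_function_continuous[OF \<theta>] test_function_continuous[OF \<eta>]
        test_function_partial_continuous[OF \<theta> b] test_function_partial_continuous[OF \<eta> b])
  moreover have "integrable (lebesgue_on \<Omega>) (\<lambda>x. \<theta> x * partial b \<eta> x)"
    "integrable (lebesgue_on \<Omega>) (\<lambda>x. partial b \<theta> x * \<eta> x)"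
    using L2_integrable_inner[OF test_function_L2(1)[OF assms] test_function_L2(2)[OF \<open>open \<Omega>\<close> \<eta> b]]
      L2_integrable_inner[OF test_function_L2(2)[OF assms b] test_function_L2(1)[OF \<open>open \<Omega>\<close> \<eta>]]
    by simp_all
  ultimately show "(LINT x|lebesgue_on \<Omega>. \<theta> x * partial b \<eta> x) =
      - (LINT x|lebesgue_on \<Omega>. (gradient \<theta> x \<bullet> b) * \<eta> x)"
    using b by (simp add: gradient_inner_Basis)
qed

section \<open>Weak gradients and divergences\<close>

lemma wgrad_props:
  assumes "\<phi> \<in> H1 \<Omega>"
  shows "wgrad \<Omega> \<phi> \<in> L2 \<Omega>" and "is_weak_gradient \<Omega> \<phi> (wgrad \<Omega> \<phi>)"
proof -
  have "\<exists>g. g \<in> L2 \<Omega> \<and> is_weak_gradient \<Omega> \<phi> g" using assms by (auto simp: H1_def)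
  from someI_ex[OF this] show "wgrad \<Omega> \<phi> \<in> L2 \<Omega>" "is_weak_gradient \<Omega> \<phi> (wgrad \<Omega> \<phi>)"
    unfolding wgrad_def by blast+
qed

lemma wdiv_props:
  assumes "\<psi> \<in> Hdiv \<Omega>"
  shows "wdiv \<Omega> \<psi> \<in> L2 \<Omega>" and "is_weak_divergence \<Omega> \<psi> (wdiv \<Omega> \<psi>)"
proof -
  have "\<exists>w. w \<in> L2 \<Omega> \<and> is_weak_divergence \<Omega> \<psi> w" using assms by (auto simp: Hdiv_def)
  from someI_ex[OF this] show "wdiv \<Omega> \<psi> \<in> L2 \<Omega>" "is_weak_divergence \<Omega> \<psi> (wdiv \<Omega> \<psi>)"
    unfolding wdiv_def by blast+
qed

lemma integrable_L2_mult:
  fixes f g :: "'a::euclidean_space \<Rightarrow> real"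
  assumes "f \<in> L2 \<Omega>" "g \<in> L2 \<Omega>"
  shows "integrable (lebesgue_on \<Omega>) (\<lambda>x. f x * g x)"
  using L2_integrable_inner[OF assms] by simp

text \<open>Each component of the difference of two weak gradients is orthogonal to all test
  functions.\<close>

lemma weak_gradient_unique:
  assumes "open \<Omega>" "g \<in> L2 \<Omega>" "g' \<in> L2 \<Omega>" "is_weak_gradient \<Omega> \<phi> g" "is_weak_gradient \<Omega> \<phi> g'"
  shows "AE x in lebesgue_on \<Omega>. g x = g' x"
proof -
  have "AE x in lebesgue_on \<Omega>. g x \<bullet> b - g' x \<bullet> b = 0" if b: "b \<in> Basis" for b
  proof (rule AE_zero_if_L2_orthogonal_test_functions[OF \<open>open \<Omega>\<close>])
    show "(\<lambda>x. g x \<bullet> b - g' x \<bullet> b) \<in> L2 \<Omega>"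
      using assms by (intro L2_diff L2_component)
    fix \<theta> assume \<theta>: "\<theta> \<in> test_functions \<Omega>"
    have "(LINT x|lebesgue_on \<Omega>. (g x \<bullet> b) * \<theta> x) = (LINT x|lebesgue_on \<Omega>. (g' x \<bullet> b) * \<theta> x)"
      using assms(4,5)[unfolded is_weak_gradient_def, rule_format, OF \<theta> b] by linarith
    then show "(LINT x|lebesgue_on \<Omega>. (g x \<bullet> b - g' x \<bullet> b) * \<theta> x) = 0"
      using assms test_function_L2(1)[OF \<open>open \<Omega>\<close> \<theta>]
      by (simp add: left_diff_distrib integrable_L2_mult L2_component)
  qed
  then have "AE x in lebesgue_on \<Omega>. \<forall>b\<in>Basis. g x \<bullet> b - g' x \<bullet> b = 0"
    by (subst AE_ball_countable) (auto intro: countable_finite)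
  then show ?thesis by eventually_elim (metis euclidean_eqI right_minus_eq)
qed

lemma weak_divergence_unique:
  assumes "open \<Omega>" "w \<in> L2 \<Omega>" "w' \<in> L2 \<Omega>" "is_weak_divergence \<Omega> \<psi> w" "is_weak_divergence \<Omega> \<psi> w'"
  shows "AE x in lebesgue_on \<Omega>. w x = w' x"
proof -
  have "AE x in lebesgue_on \<Omega>. w x - w' x = 0"
  proof (rule AE_zero_if_L2_orthogonal_test_functions[OF \<open>open \<Omega>\<close>])
    fix \<theta> assume \<theta>: "\<theta> \<in> test_functions \<Omega>"
    have "(LINT x|lebesgue_on \<Omega>. w x * \<theta> x) = (LINT x|lebesgue_on \<Omega>. w' x * \<theta> x)"
      using assms(4,5)[unfolded is_weak_divergence_def, rule_format, OF \<theta>] by linarith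
    then show "(LINT x|lebesgue_on \<Omega>. (w x - w' x) * \<theta> x) = 0"
      using assms test_function_L2(1)[OF \<open>open \<Omega>\<close> \<theta>]
      by (simp add: left_diff_distrib integrable_L2_mult)
  qed (intro L2_diff assms)
  then show ?thesis by simp
qed

lemma is_weak_gradient_diff:
  assumes "open \<Omega>" "\<phi> \<in> L2 \<Omega>" "\<phi>' \<in> L2 \<Omega>" "g \<in> L2 \<Omega>" "g' \<in> L2 \<Omega>"
    "is_weak_gradient \<Omega> \<phi> g" "is_weak_gradient \<Omega> \<phi>' g'"
  shows "is_weak_gradient \<Omega> (\<lambda>x. \<phi> x - \<phi>' x) (\<lambda>x. g x - g' x)"
  unfolding is_weak_gradient_def
proof (intro ballI)
  fix \<theta> and b :: 'a assume \<theta>: "\<theta> \<in> test_functions \<Omega>" and b: "b \<in> Basis"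
  have "(LINT x|lebesgue_on \<Omega>. \<phi> x * partial b \<theta> x) = - (LINT x|lebesgue_on \<Omega>. (g x \<bullet> b) * \<theta> x)"
    "(LINT x|lebesgue_on \<Omega>. \<phi>' x * partial b \<theta> x) = - (LINT x|lebesgue_on \<Omega>. (g' x \<bullet> b) * \<theta> x)"
    using assms(6,7) \<theta> b by (auto simp: is_weak_gradient_def)
  then show "(LINT x|lebesgue_on \<Omega>. (\<phi> x - \<phi>' x) * partial b \<theta> x)
      = - (LINT x|lebesgue_on \<Omega>. ((g x - g' x) \<bullet> b) * \<theta> x)"
    using assms(2-5) test_function_L2(1)[OF \<open>open \<Omega>\<close> \<theta>] test_function_L2(2)[OF \<open>open \<Omega>\<close> \<theta> b]
    by (simp add: left_diff_distrib inner_diff_left integrable_L2_mult L2_component)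
qed

lemma is_weak_divergence_diff:
  assumes "open \<Omega>" "\<psi> \<in> L2 \<Omega>" "\<psi>' \<in> L2 \<Omega>" "w \<in> L2 \<Omega>" "w' \<in> L2 \<Omega>"
    "is_weak_divergence \<Omega> \<psi> w" "is_weak_divergence \<Omega> \<psi>' w'"
  shows "is_weak_divergence \<Omega> (\<lambda>x. \<psi> x - \<psi>' x) (\<lambda>x. w x - w' x)"
  unfolding is_weak_divergence_def
proof (intro ballI)
  fix \<theta> assume \<theta>: "\<theta> \<in> test_functions \<Omega>"
  have "(LINT x|lebesgue_on \<Omega>. \<psi> x \<bullet> gradient \<theta> x) = - (LINT x|lebesgue_on \<Omega>. w x * \<theta> x)"
    "(LINT x|lebesgue_on \<Omega>. \<psi>' x \<bullet> gradient \<theta> x) = - (LINT x|lebesgue_on \<Omega>. w' x * \<theta> x)"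
    using assms(6,7) \<theta> by (auto simp: is_weak_divergence_def)
  then show "(LINT x|lebesgue_on \<Omega>. (\<psi> x - \<psi>' x) \<bullet> gradient \<theta> x)
      = - (LINT x|lebesgue_on \<Omega>. (w x - w' x) * \<theta> x)"
    using assms(2-5) test_function_L2(1,3)[OF \<open>open \<Omega>\<close> \<theta>]
    by (simp add: left_diff_distrib inner_diff_left integrable_L2_mult L2_integrable_inner)
qed

text \<open>The difference of the chosen gradients is one weak gradient of the difference, and the
  chosen gradient of the difference is another; uniqueness makes them agree.\<close>

lemma H1_diff:
  assumes "open \<Omega>" "\<phi> \<in> H1 \<Omega>" "\<phi>' \<in> H1 \<Omega>"
  shows "(\<lambda>x. \<phi> x - \<phi>' x) \<in> H1 \<Omega>"
    and "AE x in lebesgue_on \<Omega>. wgrad \<Omega> (\<lambda>x. \<phi> x - \<phi>' x) x = wgrad \<Omega> \<phi> x - wgrad \<Omega> \<phi>' x"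
proof -
  have L2: "\<phi> \<in> L2 \<Omega>" "\<phi>' \<in> L2 \<Omega>" using assms by (auto simp: H1_def)
  note g = wgrad_props[OF assms(2)] and g' = wgrad_props[OF assms(3)]
  have weak: "is_weak_gradient \<Omega> (\<lambda>x. \<phi> x - \<phi>' x) (\<lambda>x. wgrad \<Omega> \<phi> x - wgrad \<Omega> \<phi>' x)"
    using L2 g g' by (intro is_weak_gradient_diff \<open>open \<Omega>\<close>)
  then show H1: "(\<lambda>x. \<phi> x - \<phi>' x) \<in> H1 \<Omega>"
    using L2_diff[OF L2] L2_diff[OF g(1) g'(1)] unfolding H1_def by blast
  show "AE x in lebesgue_on \<Omega>. wgrad \<Omega> (\<lambda>x. \<phi> x - \<phi>' x) x = wgrad \<Omega> \<phi> x - wgrad \<Omega> \<phi>' x"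
    by (rule weak_gradient_unique[OF \<open>open \<Omega>\<close> wgrad_props(1)[OF H1] L2_diff[OF g(1) g'(1)]
          wgrad_props(2)[OF H1] weak])
qed

lemma Hdiv_diff:
  assumes "open \<Omega>" "\<psi> \<in> Hdiv \<Omega>" "\<psi>' \<in> Hdiv \<Omega>"
  shows "(\<lambda>x. \<psi> x - \<psi>' x) \<in> Hdiv \<Omega>"
    and "AE x in lebesgue_on \<Omega>. wdiv \<Omega> (\<lambda>x. \<psi> x - \<psi>' x) x = wdiv \<Omega> \<psi> x - wdiv \<Omega> \<psi>' x"
proof -
  have L2: "\<psi> \<in> L2 \<Omega>" "\<psi>' \<in> L2 \<Omega>" using assms by (auto simp: Hdiv_def)
  note w = wdiv_props[OF assms(2)] and w' = wdiv_props[OF assms(3)]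
  have weak: "is_weak_divergence \<Omega> (\<lambda>x. \<psi> x - \<psi>' x) (\<lambda>x. wdiv \<Omega> \<psi> x - wdiv \<Omega> \<psi>' x)"
    using L2 w w' by (intro is_weak_divergence_diff \<open>open \<Omega>\<close>)
  then show Hdiv: "(\<lambda>x. \<psi> x - \<psi>' x) \<in> Hdiv \<Omega>"
    using L2_diff[OF L2] L2_diff[OF w(1) w'(1)] unfolding Hdiv_def by blast
  show "AE x in lebesgue_on \<Omega>. wdiv \<Omega> (\<lambda>x. \<psi> x - \<psi>' x) x = wdiv \<Omega> \<psi> x - wdiv \<Omega> \<psi>' x"
    by (rule weak_divergence_unique[OF \<open>open \<Omega>\<close> wdiv_props(1)[OF Hdiv] L2_diff[OF w(1) w'(1)]
          wdiv_props(2)[OF Hdiv] weak])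
qed

lemma test_function_H1:
  assumes "open \<Omega>" "\<theta> \<in> test_functions \<Omega>"
  shows "\<theta> \<in> H1 \<Omega>"
  using test_function_L2(1,3)[OF assms] test_function_is_weak_gradient[OF assms]
  by (auto simp: H1_def)

lemma wgrad_test_function:
  assumes "open \<Omega>" "\<theta> \<in> test_functions \<Omega>"
  shows "AE x in lebesgue_on \<Omega>. wgrad \<Omega> \<theta> x = gradient \<theta> x"
  using wgrad_props[OF test_function_H1[OF assms]] test_function_L2(3)[OF assms]
    test_function_is_weak_gradient[OF assms]
  by (intro weak_gradient_unique[OF \<open>open \<Omega>\<close>])

lemma L2_norm_le_H1_norm: "L2_norm \<Omega> \<phi> \<le> H1_norm \<Omega> \<phi>"
  and L2_norm_wgrad_le_H1_norm: "L2_norm \<Omega> (wgrad \<Omega> \<phi>) \<le> H1_norm \<Omega> \<phi>"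
  unfolding H1_norm_def by (auto intro!: real_le_rsqrt)

lemma H1_norm_le_sum: "H1_norm \<Omega> \<phi> \<le> L2_norm \<Omega> \<phi> + L2_norm \<Omega> (wgrad \<Omega> \<phi>)"
  unfolding H1_norm_def by (intro sqrt_sum_squares_le_sum L2_norm_nonneg)

text \<open>The crude factor \<open>2\<close> suffices for density arguments and spares the sharp triangle inequality
  for the combined norm.\<close>

lemma H1_norm_diff_le:
  assumes "open \<Omega>" "\<phi> \<in> H1 \<Omega>" "\<phi>' \<in> H1 \<Omega>"
  shows "H1_norm \<Omega> (\<lambda>x. \<phi> x - \<phi>' x) \<le> 2 * (H1_norm \<Omega> \<phi> + H1_norm \<Omega> \<phi>')"
proof -
  note g = wgrad_props(1)[OF assms(2)] wgrad_props(1)[OF assms(3)]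
  have "L2_norm \<Omega> (wgrad \<Omega> (\<lambda>x. \<phi> x - \<phi>' x)) = L2_norm \<Omega> (\<lambda>x. wgrad \<Omega> \<phi> x - wgrad \<Omega> \<phi>' x)"
    by (rule L2_norm_cong_AE[OF wgrad_props(1)[OF H1_diff(1)[OF assms]] L2_diff[OF g] H1_diff(2)[OF assms]])
  also have "\<dots> \<le> L2_norm \<Omega> (wgrad \<Omega> \<phi>) + L2_norm \<Omega> (wgrad \<Omega> \<phi>')"
    by (rule L2_norm_diff_le[OF g])
  finally have "L2_norm \<Omega> (wgrad \<Omega> (\<lambda>x. \<phi> x - \<phi>' x)) \<le> H1_norm \<Omega> \<phi> + H1_norm \<Omega> \<phi>'"
    using L2_norm_wgrad_le_H1_norm[of \<Omega> \<phi>] L2_norm_wgrad_le_H1_norm[of \<Omega> \<phi>'] by linarith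
  moreover have "\<phi> \<in> L2 \<Omega>" "\<phi>' \<in> L2 \<Omega>" using assms by (simp_all add: H1_def)
  then have "L2_norm \<Omega> (\<lambda>x. \<phi> x - \<phi>' x) \<le> H1_norm \<Omega> \<phi> + H1_norm \<Omega> \<phi>'"
    using L2_norm_diff_le[of \<phi> \<Omega> \<phi>'] L2_norm_le_H1_norm[of \<Omega> \<phi>] L2_norm_le_H1_norm[of \<Omega> \<phi>']
    by linarith
  ultimately have "L2_norm \<Omega> (\<lambda>x. \<phi> x - \<phi>' x) + L2_norm \<Omega> (wgrad \<Omega> (\<lambda>x. \<phi> x - \<phi>' x))
      \<le> (H1_norm \<Omega> \<phi> + H1_norm \<Omega> \<phi>') + (H1_norm \<Omega> \<phi> + H1_norm \<Omega> \<phi>')"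
    by (intro add_mono)
  with H1_norm_le_sum[of \<Omega> "\<lambda>x. \<phi> x - \<phi>' x"] show ?thesis unfolding mult_2 by (rule order_trans)
qed

lemma H1_0_diff:
  assumes "open \<Omega>" "\<phi> \<in> H1_0 \<Omega>" "\<phi>' \<in> H1_0 \<Omega>"
  shows "(\<lambda>x. \<phi> x - \<phi>' x) \<in> H1_0 \<Omega>"
proof -
  have H1: "\<phi> \<in> H1 \<Omega>" "\<phi>' \<in> H1 \<Omega>" using assms by (auto simp: H1_0_def)
  have "\<exists>\<theta>\<in>test_functions \<Omega>. H1_norm \<Omega> (\<lambda>x. (\<phi> x - \<phi>' x) - \<theta> x) < \<epsilon>" if "\<epsilon> > 0" for \<epsilon>
  proof -
    have "\<epsilon> / 4 > 0" using that by simp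
    then obtain \<theta> \<theta>' where \<theta>: "\<theta> \<in> test_functions \<Omega>" "H1_norm \<Omega> (\<lambda>x. \<phi> x - \<theta> x) < \<epsilon> / 4"
      and \<theta>': "\<theta>' \<in> test_functions \<Omega>" "H1_norm \<Omega> (\<lambda>x. \<phi>' x - \<theta>' x) < \<epsilon> / 4"
      using assms(2,3) unfolding H1_0_def mem_Collect_eq by meson
    have "(\<lambda>x. (\<phi> x - \<phi>' x) - (\<theta> x - \<theta>' x)) = (\<lambda>x. (\<phi> x - \<theta> x) - (\<phi>' x - \<theta>' x))" by auto
    moreover have "H1_norm \<Omega> (\<lambda>x. (\<phi> x - \<theta> x) - (\<phi>' x - \<theta>' x))
        \<le> 2 * (H1_norm \<Omega> (\<lambda>x. \<phi> x - \<theta> x) + H1_norm \<Omega> (\<lambda>x. \<phi>' x - \<theta>' x))"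
      using H1 \<theta>(1) \<theta>'(1) test_function_H1[OF \<open>open \<Omega>\<close>]
      by (intro H1_norm_diff_le H1_diff(1) \<open>open \<Omega>\<close>)
    ultimately show ?thesis
      using \<theta> \<theta>' by (intro bexI[of _ "\<lambda>x. \<theta> x - \<theta>' x"] test_function_diff) auto
  qed
  with H1_diff(1)[OF \<open>open \<Omega>\<close> H1] show ?thesis by (auto simp: H1_0_def)
qed

section \<open>Green's formula and the error estimates\<close>

text \<open>For a test function in place of \<open>\<phi>\<close> the formula is the definition of the weak divergence. Both
  sides are continuous in \<open>\<phi>\<close> with respect to the graph norm of \<open>H1\<close>, so it carries over to the
  closure.\<close>

lemma Green_formula:
  assumes "open \<Omega>" and \<phi>: "\<phi> \<in> H1_0 \<Omega>" and \<psi>: "\<psi> \<in> Hdiv \<Omega>"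
  shows "L2_inner \<Omega> (wgrad \<Omega> \<phi>) \<psi> = - L2_inner \<Omega> \<phi> (wdiv \<Omega> \<psi>)"
proof -
  have H1: "\<phi> \<in> H1 \<Omega>" and L2: "\<phi> \<in> L2 \<Omega>" "\<psi> \<in> L2 \<Omega>"
    using \<phi> \<psi> by (auto simp: H1_0_def H1_def Hdiv_def)
  note g = wgrad_props(1)[OF H1] and w = wdiv_props[OF \<psi>]
  let ?C = "L2_norm \<Omega> \<psi> + L2_norm \<Omega> (wdiv \<Omega> \<psi>)"
  let ?d = "L2_inner \<Omega> (wgrad \<Omega> \<phi>) \<psi> + L2_inner \<Omega> \<phi> (wdiv \<Omega> \<psi>)"
  have "\<bar>?d\<bar> \<le> \<epsilon> * ?C" if "\<epsilon> > 0" for \<epsilon>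
  proof -
    obtain \<theta> where \<theta>: "\<theta> \<in> test_functions \<Omega>" "H1_norm \<Omega> (\<lambda>x. \<phi> x - \<theta> x) < \<epsilon>"
      using \<phi> \<open>\<epsilon> > 0\<close> by (auto simp: H1_0_def)
    note \<theta>H1 = test_function_H1[OF \<open>open \<Omega>\<close> \<theta>(1)]
    note \<theta>L2 = test_function_L2(1,3)[OF \<open>open \<Omega>\<close> \<theta>(1)]
    note diff = H1_diff[OF \<open>open \<Omega>\<close> H1 \<theta>H1]
    have \<delta>L2: "wgrad \<Omega> (\<lambda>x. \<phi> x - \<theta> x) \<in> L2 \<Omega>" "(\<lambda>x. \<phi> x - \<theta> x) \<in> L2 \<Omega>"
      using wgrad_props(1)[OF diff(1)] L2 \<theta>L2 by (auto intro: L2_diff)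
    have "AE x in lebesgue_on \<Omega>. wgrad \<Omega> (\<lambda>x. \<phi> x - \<theta> x) x = wgrad \<Omega> \<phi> x - gradient \<theta> x"
      using diff(2) wgrad_test_function[OF \<open>open \<Omega>\<close> \<theta>(1)] by eventually_elim simp
    then have "L2_inner \<Omega> (wgrad \<Omega> (\<lambda>x. \<phi> x - \<theta> x)) \<psi> = L2_inner \<Omega> (\<lambda>x. wgrad \<Omega> \<phi> x - gradient \<theta> x) \<psi>"
      using \<delta>L2 g \<theta>L2 L2 by (intro L2_inner_cong_AE L2_diff)
    moreover have "L2_inner \<Omega> (gradient \<theta>) \<psi> = - L2_inner \<Omega> \<theta> (wdiv \<Omega> \<psi>)"
      using w(2) \<theta>(1) by (simp add: is_weak_divergence_def L2_inner_def inner_commute mult.commute)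
    ultimately have "?d = L2_inner \<Omega> (wgrad \<Omega> (\<lambda>x. \<phi> x - \<theta> x)) \<psi> + L2_inner \<Omega> (\<lambda>x. \<phi> x - \<theta> x) (wdiv \<Omega> \<psi>)"
      using g \<theta>L2 L2 w(1) by (simp add: L2_inner_diff_left)
    also have "\<bar>\<dots>\<bar> \<le> L2_norm \<Omega> (wgrad \<Omega> (\<lambda>x. \<phi> x - \<theta> x)) * L2_norm \<Omega> \<psi>
        + L2_norm \<Omega> (\<lambda>x. \<phi> x - \<theta> x) * L2_norm \<Omega> (wdiv \<Omega> \<psi>)"
      using L2_Cauchy_Schwarz[OF \<delta>L2(1) L2(2)] L2_Cauchy_Schwarz[OF \<delta>L2(2) w(1)] by linarith
    also have "\<dots> \<le> \<epsilon> * L2_norm \<Omega> \<psi> + \<epsilon> * L2_norm \<Omega> (wdiv \<Omega> \<psi>)"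
      using \<theta>(2) L2_norm_wgrad_le_H1_norm[of \<Omega> "\<lambda>x. \<phi> x - \<theta> x"] L2_norm_le_H1_norm[of \<Omega> "\<lambda>x. \<phi> x - \<theta> x"]
      by (intro add_mono mult_right_mono L2_norm_nonneg) auto
    finally show ?thesis by (simp add: distrib_left)
  qed
  note bound = this
  have "0 \<le> ?C" by (simp add: L2_norm_nonneg)
  have "\<bar>?d\<bar> \<le> 0"
  proof (rule field_le_epsilon)
    fix e :: real assume "e > 0"
    then have "\<bar>?d\<bar> \<le> e / (?C + 1) * ?C" using \<open>0 \<le> ?C\<close> by (intro bound) simp
    also have "\<dots> \<le> e" using \<open>e > 0\<close> \<open>0 \<le> ?C\<close> by (simp add: field_simps)
    finally show "\<bar>?d\<bar> \<le> 0 + e" by simp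
  qed
  then show ?thesis by simp
qed

text \<open>Here \<open>g\<close>, \<open>q\<close> and \<open>w\<close> stand for the norms of \<open>\<nabla>e\<close>, \<open>q\<close> and \<open>div q\<close>, \<open>D\<close> for the squared
  flux residual \<open>\<parallel>\<nabla>e - q\<parallel>\<^sup>2\<close>, and \<open>i\<close> for the inner product of \<open>e\<close> and \<open>div q\<close>. The bound from below
  uses Young's inequality as \<open>2 c g w \<le> c\<^sup>2 g\<^sup>2 + w\<^sup>2\<close>. The bound from above uses it as
  \<open>2 c g w \<le> g\<^sup>2 / 2 + 2 c\<^sup>2 w\<^sup>2\<close>, so that half of \<open>g\<^sup>2\<close> can be absorbed on the left; multiplying by
  two restores the full error and produces the constants \<open>4 c\<^sup>2\<close> and \<open>2\<close>.\<close>

lemma error_residual_estimates: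
  fixes g q w i c D :: real
  assumes D: "D = g\<^sup>2 + q\<^sup>2 + 2 * i" and i: "\<bar>i\<bar> \<le> c * g * w"
    and D2: "D \<le> 2 * (g\<^sup>2 + q\<^sup>2)"
  shows "max (w\<^sup>2 + 1 / 2 * D) (1 / (1 + c\<^sup>2) * D) \<le> g\<^sup>2 + (q\<^sup>2 + w\<^sup>2)"
    and "g\<^sup>2 + (q\<^sup>2 + w\<^sup>2) \<le> (1 + 4 * c\<^sup>2) * w\<^sup>2 + 2 * D"
proof -
  have "2 * c * g * w \<le> c\<^sup>2 * g\<^sup>2 + w\<^sup>2"
    using zero_le_power2[of "c * g - w"] by (simp add: power2_eq_square algebra_simps)
  then have "D \<le> g\<^sup>2 + q\<^sup>2 + c\<^sup>2 * g\<^sup>2 + w\<^sup>2" using D i by (simp add: abs_le_iff)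
  also have "\<dots> \<le> (1 + c\<^sup>2) * (g\<^sup>2 + (q\<^sup>2 + w\<^sup>2))"
    by (simp add: algebra_simps)
  finally have "D \<le> (1 + c\<^sup>2) * (g\<^sup>2 + (q\<^sup>2 + w\<^sup>2))" .
  moreover have "0 < 1 + c\<^sup>2" by (simp add: add_pos_nonneg)
  ultimately have "1 / (1 + c\<^sup>2) * D \<le> g\<^sup>2 + (q\<^sup>2 + w\<^sup>2)"
    by (simp add: pos_divide_le_eq mult.commute)
  then show "max (w\<^sup>2 + 1 / 2 * D) (1 / (1 + c\<^sup>2) * D) \<le> g\<^sup>2 + (q\<^sup>2 + w\<^sup>2)"
    using D2 by simp
  have "4 * (c * g * w) \<le> g\<^sup>2 + 4 * c\<^sup>2 * w\<^sup>2"
    using zero_le_power2[of "g - 2 * c * w"] by (simp add: power2_eq_square algebra_simps)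
  then have "g\<^sup>2 + 2 * q\<^sup>2 \<le> 2 * D + 4 * c\<^sup>2 * w\<^sup>2"
    using D i by (simp add: abs_le_iff)
  moreover have "0 \<le> q\<^sup>2" by simp
  moreover have "(1 + 4 * c\<^sup>2) * w\<^sup>2 = w\<^sup>2 + 4 * c\<^sup>2 * w\<^sup>2" by (simp add: algebra_simps)
  ultimately show "g\<^sup>2 + (q\<^sup>2 + w\<^sup>2) \<le> (1 + 4 * c\<^sup>2) * w\<^sup>2 + 2 * D" by linarith
qed

theorem theorem2p12:
  fixes \<Omega> :: "'a::euclidean_space set"
    and c\<^sub>f :: real
    and f u u' :: "'a \<Rightarrow> real"
    and p p' :: "'a \<Rightarrow> 'a"
  assumes "domain_set \<Omega>"
    and "bounded_in_one_direction \<Omega>"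
    and "friedrichs_constant \<Omega> c\<^sub>f"
    and "f \<in> L2 \<Omega>"
    and "poisson_solution \<Omega> f u p"
    and "u' \<in> H1_0 \<Omega>"
    and "p' \<in> Hdiv \<Omega>"
  shows "max ((L2_norm \<Omega> (\<lambda>x. f x + wdiv \<Omega> p' x))\<^sup>2
                + 1 / 2 * (L2_norm \<Omega> (\<lambda>x. p' x - wgrad \<Omega> u' x))\<^sup>2)
             (1 / (1 + c\<^sub>f\<^sup>2) * (L2_norm \<Omega> (\<lambda>x. p' x - wgrad \<Omega> u' x))\<^sup>2)
           \<le> (L2_norm \<Omega> (wgrad \<Omega> (\<lambda>x. u x - u' x)))\<^sup>2 + (Hdiv_norm \<Omega> (\<lambda>x. p x - p' x))\<^sup>2
       \<and> (L2_norm \<Omega> (wgrad \<Omega> (\<lambda>x. u x - u' x)))\<^sup>2 + (Hdiv_norm \<Omega> (\<lambda>x. p x - p' x))\<^sup>2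
           \<le> (1 + 4 * c\<^sub>f\<^sup>2) * (L2_norm \<Omega> (\<lambda>x. f x + wdiv \<Omega> p' x))\<^sup>2
              + 2 * (L2_norm \<Omega> (\<lambda>x. p' x - wgrad \<Omega> u' x))\<^sup>2"
proof -
  have op: "open \<Omega>" using assms(1) by (simp add: domain_set_def)
  have u: "u \<in> H1_0 \<Omega>" and p: "p \<in> Hdiv \<Omega>"
    and pu: "AE x in lebesgue_on \<Omega>. - wgrad \<Omega> u x + p x = 0"
    and pf: "AE x in lebesgue_on \<Omega>. - wdiv \<Omega> p x = f x"
    using assms(5) by (auto simp: poisson_solution_def)
  define e q where "e = (\<lambda>x. u x - u' x)" and "q = (\<lambda>x. p x - p' x)"
  have e: "e \<in> H1_0 \<Omega>" unfolding e_def by (rule H1_0_diff[OF op u assms(6)])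
  have H1: "u \<in> H1 \<Omega>" "u' \<in> H1 \<Omega>" "e \<in> H1 \<Omega>" using u assms(6) e by (auto simp: H1_0_def)
  have q: "q \<in> Hdiv \<Omega>" unfolding q_def by (rule Hdiv_diff(1)[OF op p assms(7)])
  have L2: "e \<in> L2 \<Omega>" "q \<in> L2 \<Omega>" "p' \<in> L2 \<Omega>"
    using H1 q assms(7) by (simp_all add: H1_def Hdiv_def)
  note L2' = wgrad_props(1)[OF H1(3)] wgrad_props(1)[OF H1(2)] wdiv_props(1)[OF q] wdiv_props(1)[OF assms(7)]
  have flux: "L2_norm \<Omega> (\<lambda>x. p' x - wgrad \<Omega> u' x) = L2_norm \<Omega> (\<lambda>x. wgrad \<Omega> e x - q x)"
  proof (intro L2_norm_cong_AE L2_diff L2 L2')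
    show "AE x in lebesgue_on \<Omega>. p' x - wgrad \<Omega> u' x = wgrad \<Omega> e x - q x"
      using H1_diff(2)[OF op H1(1,2)] pu
      by eventually_elim (simp add: e_def q_def algebra_simps)
  qed
  have div: "L2_norm \<Omega> (\<lambda>x. f x + wdiv \<Omega> p' x) = L2_norm \<Omega> (wdiv \<Omega> q)"
  proof -
    have "AE x in lebesgue_on \<Omega>. norm (f x + wdiv \<Omega> p' x) = norm (wdiv \<Omega> q x)"
      using Hdiv_diff(2)[OF op p assms(7)] pf by eventually_elim (simp add: q_def)
    then have "AE x in lebesgue_on \<Omega>. (norm (f x + wdiv \<Omega> p' x))\<^sup>2 = (norm (wdiv \<Omega> q x))\<^sup>2"
      by eventually_elim (simp only:)
    then show ?thesis
      unfolding L2_norm_def using assms(4) L2'(3,4)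
      by (intro arg_cong[where f = sqrt] integral_cong_AE) (auto simp: L2_def)
  qed
  let ?g = "L2_norm \<Omega> (wgrad \<Omega> e)" and ?q = "L2_norm \<Omega> q" and ?w = "L2_norm \<Omega> (wdiv \<Omega> q)"
  let ?D = "(L2_norm \<Omega> (\<lambda>x. wgrad \<Omega> e x - q x))\<^sup>2" and ?i = "L2_inner \<Omega> e (wdiv \<Omega> q)"
  have D: "?D = ?g\<^sup>2 + ?q\<^sup>2 + 2 * ?i"
    using L2_norm_diff_power2[OF L2'(1) L2(2)] Green_formula[OF op e q] by simp
  have "\<bar>?i\<bar> \<le> L2_norm \<Omega> e * ?w" by (rule L2_Cauchy_Schwarz[OF L2(1) L2'(3)])
  also have "\<dots> \<le> c\<^sub>f * ?g * ?w"
    using assms(3) e by (intro mult_right_mono L2_norm_nonneg) (auto simp: friedrichs_constant_def)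
  finally have i: "\<bar>?i\<bar> \<le> c\<^sub>f * ?g * ?w" .
  have "sqrt ?D \<le> ?g + ?q" using L2_norm_diff_le[OF L2'(1) L2(2)] by (simp add: L2_norm_nonneg)
  then have "?D \<le> (?g + ?q)\<^sup>2" by (simp add: L2_norm_nonneg power_mono)
  also have "\<dots> \<le> 2 * (?g\<^sup>2 + ?q\<^sup>2)"
    using sum_squares_bound[of ?g ?q] by (simp add: power2_sum)
  finally have D2: "?D \<le> 2 * (?g\<^sup>2 + ?q\<^sup>2)" .
  have "(Hdiv_norm \<Omega> q)\<^sup>2 = ?q\<^sup>2 + ?w\<^sup>2" by (simp add: Hdiv_norm_def)
  then show ?thesis
    using error_residual_estimates[OF D i D2]
    unfolding flux div e_def[symmetric] q_def[symmetric] by simp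
qed

end
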